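(* Let $\alpha\in(1,2)$ and let $\theta\in\mathbb{R}$ satisfy $|\theta|\le\tfrac{\pi}{\alpha}-\tfrac{\pi}{2}$. The functions $G^+$ and $G^-$ defined in the context are bounded and integrable on $\mathbb{R}$, and their Fourier transforms are given by \[ \mathcal{F}G^+(\xi)=\mathcal{F}G^-(-\xi)=\sin\tfrac{\pi}{\alpha}\left(\frac{\alpha}{\psi(\xi)-1}-\frac{1}{e^{-i\theta}\xi-1}+\frac{1}{e^{i\theta}\xi+1}\right),\qquad \xi\in\mathbb{R} \] (at points where the right-hand side has a removable singularity or $\psi$ is not explicitly given, it is understood by continuity). Furthermore, the functions $x\mapsto G^+(x)=G^-(-x)$ and $x\mapsto G^+(-x)=G^-(x)$ are completely monotone on $(0,\infty)$.
   Context: The Fourier transform of an integrable $f$ is $\mathcal{F}f(\xi)=\int_{-\infty}^\infty f(x)e^{-i\xi x}\,dx$. The function $\psi$ is given by $\psi(\xi)=e^{-i\alpha\theta}|\xi|^\alpha$ for $\xi>0$ and $\psi(\xi)=e^{i\alpha\theta}|\xi|^\alpha$ for $\xi<0$, with $\psi(0)=0$. For $x>0$ define \[ G^+(x)=G^-(-x)=\frac{\alpha\sin\frac{\pi}{\alpha}}{\pi}\int_0^\infty\frac{t^\alpha\sin(\alpha(\frac{\pi}{2}-\theta))}{t^{2\alpha}-2t^\alpha\cos(\alpha(\frac{\pi}{2}-\theta))+1}\,e^{-tx}\,dt, \] \[ G^+(-x)=G^-(x)=\frac{\alpha\sin\frac{\pi}{\alpha}}{\pi}\int_0^\infty\frac{t^\alpha\sin(\alpha(\frac{\pi}{2}+\theta))}{t^{2\alpha}-2t^\alpha\cos(\alpha(\frac{\pi}{2}+\theta))+1}\,e^{-tx}\,dt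 \] (the value at $0$ is irrelevant). A function on $(0,\infty)$ is completely monotone if it is smooth and $(-1)^nh^{(n)}\ge0$ for all $n\ge0$. *)

theory Defs
  imports "HOL-Analysis.Analysis"
begin

definition fourier :: "(real \<Rightarrow> complex) \<Rightarrow> real \<Rightarrow> complex" where
  "fourier f \<xi> = (CLBINT x. f x * exp (- (\<i> * complex_of_real \<xi> * complex_of_real x)))"

definition psi :: "real \<Rightarrow> real \<Rightarrow> real \<Rightarrow> complex" where
  "psi \<alpha> \<theta> \<xi> =
     (if \<xi> > 0 then exp (- (\<i> * complex_of_real (\<alpha> * \<theta>))) * complex_of_real (\<bar>\<xi>\<bar> powr \<alpha>)
      else if \<xi> < 0 then exp (\<i> * complex_of_real (\<alpha> * \<theta>)) * complex_of_real (\<bar>\<xi>\<bar> powr \<alpha>)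
      else 0)"

(* The integral shared by the two defining formulas of the functions G, which differ only in
   the angle \<phi> = \<alpha> (\<pi>/2 - \<theta>) or \<phi> = \<alpha> (\<pi>/2 + \<theta>). *)
definition G_integral :: "real \<Rightarrow> real \<Rightarrow> real \<Rightarrow> real" where
  "G_integral \<alpha> \<phi> x =
     \<alpha> * sin (pi / \<alpha>) / pi *
     (LBINT t:{0<..}.
        t powr \<alpha> * sin \<phi> / (t powr (2 * \<alpha>) - 2 * t powr \<alpha> * cos \<phi> + 1) * exp (- (t * x)))"

(* The value at 0 is irrelevant; 0 is an arbitrary choice. *)
definition Gplus :: "real \<Rightarrow> real \<Rightarrow> real \<Rightarrow> real" where
  "Gplus \<alpha> \<theta> x =
     (if x > 0 then G_integral \<alpha> (\<alpha> * (pi / 2 - \<theta>)) x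
      else if x < 0 then G_integral \<alpha> (\<alpha> * (pi / 2 + \<theta>)) (- x)
      else 0)"

definition Gminus :: "real \<Rightarrow> real \<Rightarrow> real \<Rightarrow> real" where
  "Gminus \<alpha> \<theta> x =
     (if x > 0 then G_integral \<alpha> (\<alpha> * (pi / 2 + \<theta>)) x
      else if x < 0 then G_integral \<alpha> (\<alpha> * (pi / 2 - \<theta>)) (- x)
      else 0)"

definition G_transform :: "real \<Rightarrow> real \<Rightarrow> real \<Rightarrow> complex" where
  "G_transform \<alpha> \<theta> \<xi> =
     complex_of_real (sin (pi / \<alpha>)) *
     (complex_of_real \<alpha> / (psi \<alpha> \<theta> \<xi> - 1)
      - 1 / (exp (- (\<i> * complex_of_real \<theta>)) * complex_of_real \<xi> - 1)
      + 1 / (exp (\<i> * complex_of_real \<theta>) * complex_of_real \<xi> + 1))"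

(* Points where some denominator in G_transform vanishes, so that the formula itself (with the
   convention z / 0 = 0) is meaningless and must be read as a limit. *)
definition G_transform_singular :: "real \<Rightarrow> real \<Rightarrow> real \<Rightarrow> bool" where
  "G_transform_singular \<alpha> \<theta> \<xi> \<longleftrightarrow>
     psi \<alpha> \<theta> \<xi> - 1 = 0 \<or>
     exp (- (\<i> * complex_of_real \<theta>)) * complex_of_real \<xi> - 1 = 0 \<or>
     exp (\<i> * complex_of_real \<theta>) * complex_of_real \<xi> + 1 = 0"

(* Only the values of h on the open half-line (0,\<infinity>) matter. *)
definition completely_monotone :: "(real \<Rightarrow> real) \<Rightarrow> bool" where
  "completely_monotone h \<longleftrightarrow>
     (\<forall>n. \<forall>x>0. ((deriv ^^ n) h) field_differentiable (at x)) \<and>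
     (\<forall>n. \<forall>x>0. (- 1) ^ n * (deriv ^^ n) h x \<ge> 0)"

end

theory Submission
  imports Defs "HOL-Complex_Analysis.Complex_Analysis" "HOL-Probability.Sinc_Integral"
begin

text \<open>
  On each half-line \<open>G\<close> is a Laplace transform of a nonnegative weight, which gives complete
  monotonicity, boundedness and integrability, and by Fubini's theorem turns its Fourier transform
  into integrals of the weights against \<open>1 / (t \<plusminus> \<i> \<xi>)\<close>. Each weight is the jump
  of \<open>1 / (s powr \<alpha> - 1)\<close> between two conjugate rays; after regrouping, the four resulting ray integrals pair up
  into two integrals over full lines through \<open>0\<close>, which Cauchy's integral formula on half-discs
  evaluates: one half-plane contains the poles \<open>1\<close> and \<open>cis (- \<theta>) * \<xi>\<close>, the other only \<open>1\<close>.
  This covers \<open>\<xi> > 0\<close> away from the singularities; negative \<open>\<xi>\<close> follow by reflection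
  and the remaining points by continuity of the Fourier transform.
\<close>

section \<open>Laplace transforms\<close>

text \<open>The regrouping is forced. The two conjugate rays of one weight bound a sector, not a
  half-plane, and rotating the pole of \<open>1 / (t + \<i> * \<xi>)\<close> onto them gives two
  different points, \<open>p = \<xi> * cis (- \<theta>)\<close> and
  \<open>q = - \<xi> * cis \<theta>\<close>, so no single contour integral evaluates one weight. The
  other weight, with kernel \<open>1 / (t - \<i> * \<xi>)\<close>, produces the same two points with
  the rays exchanged: the two rays carrying \<open>p\<close> are opposite to each other, and so are
  the two carrying \<open>q\<close>. The bound on \<theta> puts both angles into the interval from 0
  to \<open>pi\<close>, where the sine is nonnegative. It also gives
  \<open>\<bar>\<theta>\<bar> < pi / 2\<close>, so that the closed half-planes meet the branch cut
  of the principal power only at 0. The boundary lines do pass through that branch point, hence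
  Cauchy's formula is used in the form that asks only for continuity up to the boundary.\<close>

definition laplace :: "(real \<Rightarrow> real) \<Rightarrow> real \<Rightarrow> real" where
  "laplace w x = (LBINT t:{0<..}. w t * exp (- (t * x)))"

text \<open>One term of the exponential series is at most the whole sum:
  \<open>(t * y) ^ n / fact n \<le> exp (t * y)\<close>.\<close>

lemma power_mult_exp_minus_le:
  fixes t y :: real
  assumes "t \<ge> 0" "y > 0"
  shows "t ^ n * exp (- (t * y)) \<le> fact n / y ^ n"
proof -
  have "(t * y) ^ n / fact n \<le> exp (t * y)"
  proof -
    have "sum (\<lambda>k. (t * y) ^ k /\<^sub>R fact k) {n} \<le> exp (t * y)"
      unfolding exp_def using assms
      by (intro sum_le_suminf summable_exp_generic) auto
    then show ?thesis by (simp add: field_simps)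
  qed
  then have "(t * y) ^ n \<le> fact n * exp (t * y)"
    by (simp add: field_simps)
  then have "t ^ n * y ^ n * exp (- (t * y)) \<le> fact n * exp (t * y) * exp (- (t * y))"
    by (intro mult_right_mono) (auto simp: power_mult_distrib)
  then show ?thesis
    using assms by (simp add: field_simps exp_minus)
qed

text \<open>For fixed \<open>x > 0\<close> the exponential absorbs \<open>t ^ n\<close> up to the
  constant \<open>fact n / x ^ n\<close>. Hence integrability of the weight alone controls all
  derivatives of its Laplace transform.\<close>

lemma set_integrable_exp_weight:
  fixes w :: "real \<Rightarrow> real"
  assumes w: "set_integrable lborel {0<..} w" and x: "x > 0"
  shows "set_integrable lborel {0<..} (\<lambda>t. t ^ n * w t * exp (- (t * x)))"
proof (rule set_integrable_bound)
  show "set_integrable lborel {0<..} (\<lambda>t. fact n / x ^ n * w t)"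
    using w by simp
  have [measurable]: "(\<lambda>t. indicator {0<..} t * w t) \<in> borel_measurable borel"
    using w unfolding set_integrable_def by simp
  have "(\<lambda>t. indicator {0<..} t *\<^sub>R (t ^ n * w t * exp (- (t * x))))
      = (\<lambda>t. (indicator {0<..} t * w t) * (t ^ n * exp (- (t * x))))"
    by (auto simp: fun_eq_iff)
  then show "set_borel_measurable lborel {0<..} (\<lambda>t. t ^ n * w t * exp (- (t * x)))"
    unfolding set_borel_measurable_def by simp
  show "AE t in lborel. t \<in> {0<..} \<longrightarrow>
      norm (t ^ n * w t * exp (- (t * x))) \<le> norm (fact n / x ^ n * w t)"
  proof (intro AE_I2 impI)
    fix t :: real assume t: "t \<in> {0<..}"
    have "t ^ n * exp (- (t * x)) * \<bar>w t\<bar> \<le> fact n / x ^ n * \<bar>w t\<bar>"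
      using t x by (intro mult_right_mono power_mult_exp_minus_le) auto
    then show "norm (t ^ n * w t * exp (- (t * x))) \<le> norm (fact n / x ^ n * w t)"
      using t x by (simp add: abs_mult mult_ac)
  qed
qed

text \<open>Mean value inequality on \<open>{z<..}\<close>, where the derivative of
  \<open>exp (- (t * u))\<close> in \<open>u\<close> is largest in modulus near \<open>z\<close>.
  The bound does not depend on \<open>x\<close> and \<open>y\<close>, so it can dominate a whole
  sequence of difference quotients.\<close>

lemma exp_minus_diff_quotient_le:
  fixes t x y z :: real
  assumes "t \<ge> 0" "z < x" "z < y" "x \<noteq> y"
  shows "\<bar>(exp (- (t * y)) - exp (- (t * x))) / (y - x)\<bar> \<le> t * exp (- (t * z))"
proof -
  have "norm (exp (- (t * y)) - exp (- (t * x))) \<le> t * exp (- (t * z)) * norm (y - x)"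
  proof (rule field_differentiable_bound[where S = "{z<..}"
        and f = "\<lambda>u. exp (- (t * u))" and f' = "\<lambda>u. - t * exp (- (t * u))"])
    show "norm (- t * exp (- (t * u))) \<le> t * exp (- (t * z))" if "u \<in> {z<..}" for u
      using that assms by (auto simp: abs_mult intro!: mult_left_mono)
  qed (use assms in \<open>auto intro!: derivative_eq_intros\<close>)
  then show ?thesis
    using assms by (simp add: field_simps abs_div)
qed

lemma laplace_has_field_derivative:
  assumes w0: "\<And>y. y > 0 \<Longrightarrow> set_integrable lborel {0<..} (\<lambda>t. w t * exp (- (t * y)))"
    and w1: "\<And>y. y > 0 \<Longrightarrow> set_integrable lborel {0<..} (\<lambda>t. - t * w t * exp (- (t * y)))"
    and x: "x > 0"
  shows "(laplace w has_field_derivative laplace (\<lambda>t. - t * w t) x) (at x)"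
proof -
  \<comment> \<open>Staying above \<open>x/2\<close> gives all difference quotients the common
    integrable majorant \<open>t * \<bar>w t\<bar> * exp (- (t * (x/2)))\<close>. The half-line is
    open, so restricting to it does not change the derivative at \<open>x\<close>.\<close>
  have "(laplace w has_field_derivative laplace (\<lambda>t. - t * w t) x) (at x within {x/2<..})"
    unfolding has_field_derivative_iff tendsto_at_iff_sequentially comp_def
  proof (intro allI impI)
    fix X :: "nat \<Rightarrow> real" assume X: "\<forall>i. X i \<in> {x/2<..} - {x}" "X \<longlonglongrightarrow> x"
    let ?q = "\<lambda>n t. w t * ((exp (- (t * X n)) - exp (- (t * x))) / (X n - x))"
    have q: "(w t * exp (- (t * X n)) - w t * exp (- (t * x))) / (X n - x) = ?q n t" for n t
      by (simp only: right_diff_distrib[symmetric] times_divide_eq_right)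
    have i0: "set_integrable lborel {0<..} (\<lambda>t. w t * exp (- (t * X n)))" for n
    proof (rule w0)
      have "X n \<in> {x/2<..}" using X(1) by blast
      then show "X n > 0" using x by simp
    qed
    have eq: "(laplace w (X n) - laplace w x) / (X n - x) = (LBINT t:{0<..}. ?q n t)" for n
    proof -
      have "(laplace w (X n) - laplace w x) / (X n - x)
          = (LBINT t:{0<..}. (w t * exp (- (t * X n)) - w t * exp (- (t * x))) / (X n - x))"
        using i0[of n] w0[OF x] by (simp only: laplace_def set_integral_diff set_integral_divide_zero)
      then show ?thesis unfolding q .
    qed
    have qi: "set_integrable lborel {0<..} (?q n)" for n
    proof -
      have "set_integrable lborel {0<..} (\<lambda>t. (w t * exp (- (t * X n)) - w t * exp (- (t * x))) / (X n - x))"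
        using i0[of n] w0[OF x] by (intro set_integrable_divide set_integral_diff(1))
      then show ?thesis unfolding q .
    qed
    have "(\<lambda>n. LBINT t:{0<..}. ?q n t) \<longlonglongrightarrow> laplace (\<lambda>t. - t * w t) x"
      unfolding laplace_def set_lebesgue_integral_def
    proof (rule integral_dominated_convergence)
      show "(\<lambda>t. indicator {0<..} t *\<^sub>R (- t * w t * exp (- (t * x)))) \<in> borel_measurable lborel"
        using w1[OF x] unfolding set_integrable_def by (rule borel_measurable_integrable)
      show "(\<lambda>t. indicator {0<..} t *\<^sub>R ?q n t) \<in> borel_measurable lborel" for n
        using qi[of n] unfolding set_integrable_def by (rule borel_measurable_integrable)
      show "integrable lborel (\<lambda>t. norm (indicator {0<..} t *\<^sub>R (- t * w t * exp (- (t * (x/2))))))"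
        using w1[of "x/2"] x unfolding set_integrable_def by (intro integrable_norm) simp
      show "AE t in lborel. (\<lambda>n. indicator {0<..} t *\<^sub>R ?q n t)
          \<longlonglongrightarrow> indicator {0<..} t *\<^sub>R (- t * w t * exp (- (t * x)))"
      proof (rule AE_I2)
        fix t :: real
        have "((\<lambda>u. exp (- (t * u))) has_field_derivative - t * exp (- (t * x))) (at x within {x/2<..})"
          by (auto intro!: derivative_eq_intros)
        then have "(\<lambda>n. (exp (- (t * X n)) - exp (- (t * x))) / (X n - x)) \<longlonglongrightarrow> - t * exp (- (t * x))"
          using X by (simp add: has_field_derivative_iff tendsto_at_iff_sequentially comp_def)
        then have "(\<lambda>n. indicator {0<..} t *\<^sub>R ?q n t)
            \<longlonglongrightarrow> indicator {0<..} t *\<^sub>R (w t * (- t * exp (- (t * x))))"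
          by (intro tendsto_scaleR[OF tendsto_const] tendsto_mult[OF tendsto_const])
        then show "(\<lambda>n. indicator {0<..} t *\<^sub>R ?q n t)
          \<longlonglongrightarrow> indicator {0<..} t *\<^sub>R (- t * w t * exp (- (t * x)))"
          by (simp only: mult.left_commute mult_minus_left mult_minus_right mult.assoc)
      qed
      fix n
      show "AE t in lborel. norm (indicator {0<..} t *\<^sub>R ?q n t)
          \<le> norm (indicator {0<..} t *\<^sub>R (- t * w t * exp (- (t * (x/2)))))"
      proof (rule AE_I2)
        fix t :: real
        show "norm (indicator {0<..} t *\<^sub>R ?q n t)
          \<le> norm (indicator {0<..} t *\<^sub>R (- t * w t * exp (- (t * (x/2)))))"
        proof (cases "t > 0")
          case True
          have "X n \<in> {x/2<..}" "X n \<noteq> x" using X(1) by blast+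
          then have "\<bar>(exp (- (t * X n)) - exp (- (t * x))) / (X n - x)\<bar> \<le> t * exp (- (t * (x/2)))"
            using True x by (intro exp_minus_diff_quotient_le) auto
          then have "\<bar>w t\<bar> * \<bar>(exp (- (t * X n)) - exp (- (t * x))) / (X n - x)\<bar> \<le> \<bar>w t\<bar> * (t * exp (- (t * (x/2))))"
            by (rule mult_left_mono) auto
          then show ?thesis
            using True by (simp add: abs_mult mult.left_commute mult.assoc)
        qed simp
      qed
    qed
    then show "(\<lambda>n. (laplace w (X n) - laplace w x) / (X n - x)) \<longlonglongrightarrow> laplace (\<lambda>t. - t * w t) x"
      unfolding eq .
  qed
  then show ?thesis
    using x at_within_open[of x "{x/2<..}"] by simp
qed

section \<open>Complete monotonicity of Laplace transforms\<close>

text \<open>A derivative at \<open>x > 0\<close> depends only on values near \<open>x\<close>, so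
  agreement on the open half-line passes to all iterates of \<open>deriv\<close>, whatever
  \<open>h\<close> does elsewhere.\<close>

lemma funpow_deriv_eqI:
  fixes h :: "real \<Rightarrow> real"
  assumes D: "\<And>n x. x > 0 \<Longrightarrow> (D n has_field_derivative D (Suc n) x) (at x)"
    and h: "\<And>x. x > 0 \<Longrightarrow> h x = D 0 x" and "x > 0"
  shows "(deriv ^^ n) h x = D n x"
  using \<open>x > 0\<close>
proof (induction n arbitrary: x)
  case 0
  then show ?case by (simp add: h)
next
  case (Suc n)
  have "((deriv ^^ n) h has_field_derivative D (Suc n) x) (at x)"
    by (rule has_field_derivative_transform_within_open[where S = "{0<..}", OF D])
      (use Suc in simp_all)
  then show ?case by (simp add: DERIV_imp_deriv)
qed

lemma completely_monotoneI:
  fixes h :: "real \<Rightarrow> real"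
  assumes D: "\<And>n x. x > 0 \<Longrightarrow> (D n has_field_derivative D (Suc n) x) (at x)"
    and h: "\<And>x. x > 0 \<Longrightarrow> h x = D 0 x"
    and nonneg: "\<And>n x. x > 0 \<Longrightarrow> (- 1) ^ n * D n x \<ge> 0"
  shows "completely_monotone h"
proof -
  have eq: "(deriv ^^ n) h x = D n x" if "x > 0" for n x
    using D h that by (rule funpow_deriv_eqI)
  have "((deriv ^^ n) h has_field_derivative D (Suc n) x) (at x)" if "x > 0" for n x
    by (rule has_field_derivative_transform_within_open[where S = "{0<..}", OF D[OF that, of n]])
      (use that in \<open>simp_all add: eq\<close>)
  then show ?thesis
    unfolding completely_monotone_def field_differentiable_def using nonneg eq by metis
qed

text \<open>Each differentiation under the integral brings down a factor \<open>- t\<close>. The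
  sign \<open>(- 1) ^ n\<close> cancels that of \<open>(- t) ^ n\<close> and leaves a nonnegative
  integrand.\<close>

lemma completely_monotone_laplace:
  assumes w: "set_integrable lborel {0<..} w" and nonneg: "\<And>t. t > 0 \<Longrightarrow> w t \<ge> 0"
    and c: "c \<ge> 0" and h: "\<And>x. x > 0 \<Longrightarrow> h x = c * laplace w x"
  shows "completely_monotone h"
proof (rule completely_monotoneI)
  let ?D = "\<lambda>n x. c * laplace (\<lambda>t. (- t) ^ n * w t) x"
  have int: "set_integrable lborel {0<..} (\<lambda>t. (- t) ^ n * w t * exp (- (t * x)))" if "x > 0" for n x
  proof -
    have eq: "(- 1) ^ n * (t ^ n * w t * exp (- (t * x))) = (- t) ^ n * w t * exp (- (t * x))" for t
      by (simp add: power_minus[of t n])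
    have "set_integrable lborel {0<..} (\<lambda>t. (- 1) ^ n * (t ^ n * w t * exp (- (t * x))))"
      using set_integrable_exp_weight[OF w that, of n] by (rule set_integrable_mult_right)
    then show ?thesis unfolding eq .
  qed
  show "(?D n has_field_derivative ?D (Suc n) x) (at x)" if "x > 0" for n x
  proof -
    have "(laplace (\<lambda>t. (- t) ^ n * w t) has_field_derivative laplace (\<lambda>t. - t * ((- t) ^ n * w t)) x) (at x)"
    proof (rule laplace_has_field_derivative)
      show "set_integrable lborel {0<..} (\<lambda>t. - t * ((- t) ^ n * w t) * exp (- (t * y)))" if "y > 0" for y
        using int[OF that, of "Suc n"] by (simp add: mult.assoc)
    qed (simp_all add: int that)
    then show ?thesis
      by (intro DERIV_cmult) (simp add: mult.assoc)
  qed
  show "h x = ?D 0 x" if "x > 0" for x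
    using h[OF that] by simp
  show "(- 1) ^ n * ?D n x \<ge> 0" if "x > 0" for n x
  proof -
    have "(- 1) ^ n * laplace (\<lambda>t. (- t) ^ n * w t) x = (LBINT t:{0<..}. t ^ n * w t * exp (- (t * x)))"
    proof -
      have "(- 1) ^ n * ((- t) ^ n * w t * exp (- (t * x))) = t ^ n * w t * exp (- (t * x))" for t
        using power_mult_distrib[of "-1" "-t" n] by (simp add: mult.assoc[symmetric])
      then show ?thesis
        unfolding laplace_def set_integral_mult_right[symmetric] by (simp only:)
    qed
    also have "\<dots> \<ge> 0"
      unfolding set_lebesgue_integral_def using nonneg
      by (intro Bochner_Integration.integral_nonneg) (auto simp: indicator_def)
    finally show ?thesis
      using mult_nonneg_nonneg[OF c] by (simp only: mult.left_commute)
  qed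
qed

lemma abs_laplace_le:
  assumes w: "set_integrable lborel {0<..} w" and nonneg: "\<And>t. t > 0 \<Longrightarrow> w t \<ge> 0" and x: "x > 0"
  shows "\<bar>laplace w x\<bar> \<le> (LBINT t:{0<..}. w t)"
proof -
  have "laplace w x \<ge> 0"
    unfolding laplace_def set_lebesgue_integral_def using nonneg
    by (intro Bochner_Integration.integral_nonneg) (auto simp: indicator_def)
  moreover have "laplace w x \<le> (LBINT t:{0<..}. w t)"
    unfolding laplace_def
  proof (rule set_integral_mono)
    show "set_integrable lborel {0<..} (\<lambda>t. w t * exp (- (t * x)))"
      using set_integrable_exp_weight[OF w x, of 0] by simp
    show "w t * exp (- (t * x)) \<le> w t" if "t \<in> {0<..}" for t
      using mult_left_mono[of "exp (- (t * x))" 1 "w t"] nonneg[of t] that x by simp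
  qed (fact w)
  ultimately show ?thesis by simp
qed

section \<open>Fourier integrals of Laplace transforms\<close>

lemma
  fixes z :: complex
  assumes z: "Re z > 0"
  shows set_integrable_exp_complex: "set_integrable lborel {0<..} (\<lambda>x. exp (- (z * complex_of_real x)))"
    and LBINT_exp_complex: "(CLBINT x:{0<..}. exp (- (z * complex_of_real x))) = 1 / z"
proof -
  show int: "set_integrable lborel {0<..} (\<lambda>x. exp (- (z * complex_of_real x)))"
  proof (rule set_integrable_bound[OF integrable_I0i_exp_mscale[OF z]])
    show "set_borel_measurable lborel {0<..} (\<lambda>x. exp (- (z * complex_of_real x)))"
      unfolding set_borel_measurable_def by measurable
  qed (simp add: mult.commute)
  have "(CLBINT x=0..\<infinity>. exp (- (z * complex_of_real x))) = 0 - (- 1 / z)"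
  proof (rule interval_integral_FTC_integrable)
    let ?F = "\<lambda>x. - exp (- (z * complex_of_real x)) / z"
    have "z \<noteq> 0" using z by auto
    then show "(?F has_vector_derivative exp (- (z * complex_of_real x))) (at x)" for x
      by (auto intro!: derivative_eq_intros has_vector_derivative_real_field)
    have "((\<lambda>x. exp (- (Re z * x))) \<longlongrightarrow> 0) at_top"
      using z by real_asymp
    then have "((\<lambda>x. norm (exp (- (z * complex_of_real x)))) \<longlongrightarrow> 0) at_top"
      by simp
    then have "((\<lambda>x. exp (- (z * complex_of_real x))) \<longlongrightarrow> 0) at_top"
      by (rule tendsto_norm_zero_cancel)
    then have "(?F \<longlongrightarrow> - 0 / z) at_top"
      using \<open>z \<noteq> 0\<close> by (intro tendsto_intros)
    then show "((?F \<circ> real_of_ereal) \<longlongrightarrow> 0) (at_left \<infinity>)"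
      by (simp add: ereal_tendsto_simps)
    have "(?F \<longlongrightarrow> ?F 0) (at_right 0)"
      using \<open>z \<noteq> 0\<close> by (intro tendsto_intros)
    then show "((?F \<circ> real_of_ereal) \<longlongrightarrow> - 1 / z) (at_right 0)"
      by (simp add: ereal_tendsto_simps zero_ereal_def)
    show "set_integrable lborel (einterval 0 \<infinity>) (\<lambda>x. exp (- (z * complex_of_real x)))"
      using int by (simp add: zero_ereal_def)
  qed (auto intro!: continuous_intros)
  then show "(CLBINT x:{0<..}. exp (- (z * complex_of_real x))) = 1 / z"
    by (simp add: interval_lebesgue_integral_0_infty)
qed

text \<open>Fubini for \<open>w t * exp (- (t + \<i> * \<xi>) * x)\<close>. Integrating its modulus
  over \<open>x\<close> gives \<open>w t / t\<close>, so the hypothesis on \<open>w t / t\<close> is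
  precisely absolute integrability on the product.\<close>

lemma laplace_fourier:
  fixes w :: "real \<Rightarrow> real" and \<xi> :: real
  assumes wt: "set_integrable lborel {0<..} (\<lambda>t. w t / t)" and nonneg: "\<And>t. t > 0 \<Longrightarrow> w t \<ge> 0"
  shows set_integrable_laplace_mult_exp:
      "set_integrable lborel {0<..} (\<lambda>x. complex_of_real (laplace w x) * exp (- (\<i> * complex_of_real \<xi> * complex_of_real x)))"
    and LBINT_laplace_mult_exp:
      "(CLBINT x:{0<..}. complex_of_real (laplace w x) * exp (- (\<i> * complex_of_real \<xi> * complex_of_real x)))
        = (CLBINT t:{0<..}. complex_of_real (w t) / (complex_of_real t + \<i> * complex_of_real \<xi>))"
proof -
  \<comment> \<open>Extension by 0 makes the weight measurable on the whole line; measurability is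
    recovered by multiplying the integrable function \<open>w t / t\<close> by
    \<open>t\<close>.\<close>
  define W where "W t = indicator {0<..} t * w t" for t
  have "(\<lambda>t. indicator {0<..} t *\<^sub>R (w t / t)) \<in> borel_measurable borel"
    using wt unfolding set_integrable_def by simp
  then have "(\<lambda>t. t * (indicator {0<..} t *\<^sub>R (w t / t))) \<in> borel_measurable borel"
    by measurable
  also have "(\<lambda>t. t * (indicator {0<..} t *\<^sub>R (w t / t))) = W"
    by (auto simp: W_def fun_eq_iff indicator_def)
  finally have W[measurable]: "W \<in> borel_measurable borel" .
  have W_nonneg: "W t \<ge> 0" for t
    using nonneg by (simp add: W_def indicator_def)
  let ?z = "\<lambda>t. complex_of_real t + \<i> * complex_of_real \<xi>"
  let ?f = "\<lambda>t x. complex_of_real (W t) * (indicator {0<..} x *\<^sub>R exp (- (?z t * complex_of_real x)))"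
  have inner_x: "integrable lborel (\<lambda>x. ?f t x)"
    and inner_x_eq: "(LINT x|lborel. ?f t x) = indicator {0<..} t *\<^sub>R (complex_of_real (w t) / ?z t)" for t
  proof -
    have "integrable lborel (\<lambda>x. ?f t x) \<and>
      (LINT x|lborel. ?f t x) = indicator {0<..} t *\<^sub>R (complex_of_real (w t) / ?z t)"
    proof (cases "t > 0")
      case True
      then show ?thesis
        using set_integrable_exp_complex[of "?z t"] LBINT_exp_complex[of "?z t"]
        by (simp add: set_integrable_def set_lebesgue_integral_def W_def del: mult_scaleR_right)
    qed (simp add: W_def)
    then show "integrable lborel (\<lambda>x. ?f t x)"
      "(LINT x|lborel. ?f t x) = indicator {0<..} t *\<^sub>R (complex_of_real (w t) / ?z t)"
      by blast+
  qed
  have inner_t_eq: "(LINT t|lborel. ?f t x)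
      = indicator {0<..} x *\<^sub>R (complex_of_real (laplace w x) * exp (- (\<i> * complex_of_real \<xi> * complex_of_real x)))" for x
  proof -
    have "?f t x = complex_of_real (indicator {0<..} t *\<^sub>R (w t * exp (- (t * x))))
        * (indicator {0<..} x *\<^sub>R exp (- (\<i> * complex_of_real \<xi> * complex_of_real x)))" for t
      by (simp add: W_def indicator_def exp_add[symmetric] exp_of_real[symmetric] algebra_simps del: exp_of_real)
    then have "(LINT t|lborel. ?f t x)
        = (LINT t|lborel. complex_of_real (indicator {0<..} t *\<^sub>R (w t * exp (- (t * x)))))
          * (indicator {0<..} x *\<^sub>R exp (- (\<i> * complex_of_real \<xi> * complex_of_real x)))"
      by (simp only: integral_mult_left_zero)
    also have "(LINT t|lborel. complex_of_real (indicator {0<..} t *\<^sub>R (w t * exp (- (t * x)))))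
        = complex_of_real (laplace w x)"
      unfolding laplace_def set_lebesgue_integral_def by (rule integral_complex_of_real)
    finally show ?thesis
      by (simp only: mult_scaleR_right)
  qed
  have int: "integrable (lborel \<Otimes>\<^sub>M lborel) (case_prod ?f)"
  proof (rule lborel_pair.Fubini_integrable)
    show "case_prod ?f \<in> borel_measurable (lborel \<Otimes>\<^sub>M lborel)"
      by measurable
    have "(LINT x|lborel. norm (?f t x)) = indicator {0<..} t *\<^sub>R (w t / t)" for t
    proof (cases "t > 0")
      case True
      have "(LINT x|lborel. norm (?f t x)) = (LINT x|lborel. w t * (indicator {0<..} x *\<^sub>R exp (- (x * t))))"
        using True nonneg[OF True] by (intro Bochner_Integration.integral_cong)
          (auto simp: W_def norm_mult indicator_def mult.commute)
      also have "\<dots> = w t * (LBINT x=0..\<infinity>. exp (- (x * t)))"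
        by (simp only: integral_mult_right_zero interval_lebesgue_integral_0_infty set_lebesgue_integral_def)
      finally show ?thesis
        using True LBINT_I0i_exp_mscale[OF True] by simp
    qed (simp add: W_def)
    then show "integrable lborel (\<lambda>t. LINT x|lborel. norm (case_prod ?f (t, x)))"
      using wt by (simp only: set_integrable_def prod.case)
    show "AE t in lborel. integrable lborel (\<lambda>x. case_prod ?f (t, x))"
      unfolding prod.case by (rule AE_I2) (rule inner_x)
  qed
  show "set_integrable lborel {0<..} (\<lambda>x. complex_of_real (laplace w x) * exp (- (\<i> * complex_of_real \<xi> * complex_of_real x)))"
    using lborel_pair.integrable_snd[OF int] unfolding inner_t_eq set_integrable_def .
  show "(CLBINT x:{0<..}. complex_of_real (laplace w x) * exp (- (\<i> * complex_of_real \<xi> * complex_of_real x)))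
        = (CLBINT t:{0<..}. complex_of_real (w t) / (complex_of_real t + \<i> * complex_of_real \<xi>))"
    using lborel_pair.Fubini_integral[OF int] unfolding inner_t_eq inner_x_eq set_lebesgue_integral_def .
qed

section \<open>Ray integrals by residues\<close>

text \<open>On the principal branch the argument of \<open>s\<close> has modulus at most
  \<open>pi\<close>. For \<open>\<alpha> < 2\<close> its multiple by \<alpha> stays strictly inside
  \<open>2 * pi\<close>, so the only admissible period is 0.\<close>

lemma powr_complex_eq_1_iff:
  fixes s :: complex and \<alpha> :: real
  assumes "0 < \<alpha>" "\<alpha> < 2"
  shows "s powr complex_of_real \<alpha> = 1 \<longleftrightarrow> s = 1"
proof
  assume eq: "s powr complex_of_real \<alpha> = 1"
  then have "s \<noteq> 0" by auto
  then have "exp (complex_of_real \<alpha> * Ln s) = 1"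
    using eq by (simp add: powr_def)
  then obtain n :: int where n: "\<alpha> * ln (cmod s) = 0" "\<alpha> * Im (Ln s) = of_int (2 * n) * pi"
    using \<open>s \<noteq> 0\<close> by (auto simp: exp_eq_1)
  have "\<bar>Im (Ln s)\<bar> \<le> pi"
    using mpi_less_Im_Ln[OF \<open>s \<noteq> 0\<close>] Im_Ln_le_pi[OF \<open>s \<noteq> 0\<close>] by linarith
  then have "\<alpha> * \<bar>Im (Ln s)\<bar> \<le> \<alpha> * pi"
    using assms by (intro mult_left_mono) auto
  also have "\<alpha> * pi < 2 * pi"
    using assms by (intro mult_strict_right_mono) auto
  finally have "\<bar>\<alpha> * Im (Ln s)\<bar> < 2 * pi"
    using assms by (simp add: abs_mult)
  then have "\<bar>real_of_int (2 * n)\<bar> * pi < 2 * pi"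
    unfolding n by (simp add: abs_mult)
  then have "n = 0"
    by simp
  then have "Ln s = 0"
    using n assms \<open>s \<noteq> 0\<close> by (simp add: complex_eq_iff)
  then show "s = 1"
    using exp_Ln[OF \<open>s \<noteq> 0\<close>] by simp
qed auto

lemma powr_of_real_mult_cis:
  fixes t \<beta> \<alpha> :: real
  assumes "t \<ge> 0" "- pi < \<beta>" "\<beta> \<le> pi"
  shows "(complex_of_real t * cis \<beta>) powr complex_of_real \<alpha> = complex_of_real (t powr \<alpha>) * cis (\<alpha> * \<beta>)"
proof (cases "t = 0")
  case False
  with assms have t: "t > 0" by simp
  have "Ln (complex_of_real t * cis \<beta>) = complex_of_real (ln t) + \<i> * complex_of_real \<beta>"
    using assms t by (intro Ln_unique) (auto simp: exp_add exp_of_real cis_conv_exp)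
  then show ?thesis
    using t by (simp add: powr_def cis_conv_exp exp_add ring_distribs mult_ac flip: exp_of_real)
qed simp

text \<open>The value at 1 is the reciprocal of the derivative of \<open>s powr \<alpha>\<close>
  there and fills the removable singularity. Thus \<open>1 / (s powr \<alpha> - 1)\<close> becomes
  \<open>unit_quot \<alpha> s / (s - 1)\<close>, a Cauchy kernel with a holomorphic
  numerator.\<close>

definition unit_quot :: "real \<Rightarrow> complex \<Rightarrow> complex" where
  "unit_quot \<alpha> s = (if s = 1 then 1 / complex_of_real \<alpha> else (s - 1) / (s powr complex_of_real \<alpha> - 1))"

text \<open>This is the reciprocal of the difference quotient of \<open>s powr \<alpha>\<close> at
  1, which extends holomorphically over 1 and has no zeros because 1 is the only solution of
  \<open>s powr \<alpha> = 1\<close>.\<close>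

lemma unit_quot_holomorphic:
  assumes "0 < \<alpha>" "\<alpha> < 2"
  shows "unit_quot \<alpha> holomorphic_on (- \<real>\<^sub>\<le>\<^sub>0)"
proof -
  let ?p = "\<lambda>s :: complex. s powr complex_of_real \<alpha>"
  let ?q = "\<lambda>s. if s = 1 then deriv ?p 1 else (?p s - ?p 1) / (s - 1)"
  have op: "open (- \<real>\<^sub>\<le>\<^sub>0 :: complex set)"
    by (simp add: open_Compl)
  have "?p holomorphic_on (- \<real>\<^sub>\<le>\<^sub>0)"
    by (intro holomorphic_intros) auto
  then have q: "?q holomorphic_on (- \<real>\<^sub>\<le>\<^sub>0)"
    using op by (rule pole_lemma_open)
  have "(?p has_field_derivative complex_of_real \<alpha>) (at 1)"
    by (auto intro!: derivative_eq_intros)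
  then have d: "deriv ?p 1 = complex_of_real \<alpha>"
    by (rule DERIV_imp_deriv)
  have "?q s \<noteq> 0" for s
    using powr_complex_eq_1_iff[OF assms, of s] d assms by auto
  then have "(\<lambda>s. 1 / ?q s) holomorphic_on (- \<real>\<^sub>\<le>\<^sub>0)"
    by (intro holomorphic_on_divide q holomorphic_on_const) auto
  moreover have "(\<lambda>s. 1 / ?q s) = unit_quot \<alpha>"
    by (auto simp: fun_eq_iff unit_quot_def d)
  ultimately show ?thesis by simp
qed

text \<open>A negative real \<open>r\<close> has inner product \<open>r * cos \<gamma> < 0\<close>
  with \<open>cis \<gamma>\<close>, so the closed half-plane meets the branch cut only at its end
  point 0.\<close>

lemma half_plane_subset_slit:
  fixes s :: complex
  assumes "\<bar>\<gamma>\<bar> < pi / 2" "cis \<gamma> \<bullet> s \<ge> 0" "s \<noteq> 0"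
  shows "s \<notin> \<real>\<^sub>\<le>\<^sub>0"
proof
  assume "s \<in> \<real>\<^sub>\<le>\<^sub>0"
  then obtain r where r: "s = complex_of_real r" "r \<le> 0"
    by (auto simp: nonpos_Reals_def)
  have "cos \<gamma> > 0"
    using assms by (intro cos_gt_zero_pi) auto
  moreover have "cos \<gamma> * r \<ge> 0" "r < 0"
    using assms r by (auto simp: inner_complex_def)
  ultimately show False
    by (simp add: zero_le_mult_iff)
qed

text \<open>The diameters of the half-discs run through the branch point. There
  \<open>s powr \<alpha>\<close> tends to 0, hence the quotient to 1, which is also its value since
  \<open>0 powr \<alpha> = 0\<close>.\<close>

lemma isCont_unit_quot_0:
  assumes "\<alpha> > 0"
  shows "isCont (unit_quot \<alpha>) 0"
proof -
  have "((\<lambda>s :: complex. s powr complex_of_real \<alpha>) \<longlongrightarrow> 0) (at 0)"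
    by (rule tendsto_powr_complex_0[OF tendsto_ident_at tendsto_const]) (simp add: assms)
  then have "((\<lambda>s :: complex. (s - 1) / (s powr complex_of_real \<alpha> - 1)) \<longlongrightarrow> (0 - 1) / (0 - 1)) (at 0)"
    by (intro tendsto_divide tendsto_diff tendsto_ident_at tendsto_const) simp_all
  moreover have "\<forall>\<^sub>F s in at 0. (s - 1) / (s powr complex_of_real \<alpha> - 1) = unit_quot \<alpha> s"
    using eventually_neq_at_within[of 1 0 UNIV]
    by (rule eventually_mono) (simp add: unit_quot_def)
  ultimately have "(unit_quot \<alpha> \<longlongrightarrow> (0 - 1) / (0 - 1)) (at 0)"
    by (rule Lim_transform_eventually)
  then have "(unit_quot \<alpha> \<longlongrightarrow> unit_quot \<alpha> 0) (at 0)"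
    by (simp add: unit_quot_def)
  then show ?thesis
    by (simp add: isCont_def)
qed

lemma
  assumes \<alpha>: "0 < \<alpha>" "\<alpha> < 2" and \<gamma>: "\<bar>\<gamma>\<bar> < pi / 2"
  shows continuous_on_unit_quot: "continuous_on {s. cis \<gamma> \<bullet> s \<ge> 0} (unit_quot \<alpha>)"
    and unit_quot_differentiable: "cis \<gamma> \<bullet> s > 0 \<Longrightarrow> unit_quot \<alpha> field_differentiable at s"
proof -
  have diff: "unit_quot \<alpha> field_differentiable at s" if "s \<notin> \<real>\<^sub>\<le>\<^sub>0" for s
    using that by (intro holomorphic_on_imp_differentiable_at[OF unit_quot_holomorphic[OF \<alpha>]]) (simp_all add: open_Compl)
  show "unit_quot \<alpha> field_differentiable at s" if "cis \<gamma> \<bullet> s > 0"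
    by (rule diff, rule half_plane_subset_slit[OF \<gamma>]) (use that in auto)
  have "isCont (unit_quot \<alpha>) s" if s: "cis \<gamma> \<bullet> s \<ge> 0" for s
  proof (cases "s = 0")
    case False
    then show ?thesis
      using diff[OF half_plane_subset_slit[OF \<gamma> s]] by (blast intro: field_differentiable_imp_continuous_at)
  next
    case True
    with isCont_unit_quot_0[OF \<alpha>(1)] show ?thesis by simp
  qed
  then show "continuous_on {s. cis \<gamma> \<bullet> s \<ge> 0} (unit_quot \<alpha>)"
    by (auto intro: continuous_at_imp_continuous_on)
qed

section \<open>The half-disc contour and its winding number\<close>

text \<open>Counterclockwise boundary; \<open>cis \<gamma>\<close> is the normal of the diameter
  pointing into the half-disc, so the enclosed side is
  \<open>cis \<gamma> \<bullet> s > 0\<close>.\<close>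

definition half_disc_path :: "real \<Rightarrow> real \<Rightarrow> real \<Rightarrow> complex" where
  "half_disc_path \<gamma> R = part_circlepath 0 R (\<gamma> - pi/2) (\<gamma> + pi/2) +++
     linepath (of_real R * cis (\<gamma> + pi/2)) (of_real R * cis (\<gamma> - pi/2))"

lemma half_disc_path_simps [simp]:
  "valid_path (half_disc_path \<gamma> R)"
  "pathfinish (half_disc_path \<gamma> R) = pathstart (half_disc_path \<gamma> R)"
  by (auto simp: half_disc_path_def cis_conv_exp)

lemma inner_cis_cis: "cis a \<bullet> (of_real r * cis b) = r * cos (b - a)"
  by (simp add: inner_complex_def cos_diff algebra_simps)

lemma path_image_half_disc_path:
  assumes "R \<ge> 0" and w: "w \<in> path_image (half_disc_path \<gamma> R)"
  shows "cis \<gamma> \<bullet> w \<ge> 0" and "cmod w = R \<or> cis \<gamma> \<bullet> w = 0"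
proof -
  consider (arc) "w \<in> path_image (part_circlepath 0 R (\<gamma> - pi/2) (\<gamma> + pi/2))"
    | (line) "w \<in> closed_segment (of_real R * cis (\<gamma> + pi/2)) (of_real R * cis (\<gamma> - pi/2))"
    using w by (auto simp: half_disc_path_def path_image_join cis_conv_exp)
  then have "cis \<gamma> \<bullet> w \<ge> 0 \<and> (cmod w = R \<or> cis \<gamma> \<bullet> w = 0)"
  proof cases
    case arc
    then obtain x where x: "x \<in> {\<gamma> - pi/2..\<gamma> + pi/2}" "w = of_real R * cis x"
      by (auto simp: path_image_part_circlepath' closed_segment_eq_real_ivl)
    have "cos (x - \<gamma>) \<ge> 0"
      using x by (intro cos_ge_zero) auto
    then show ?thesis
      using x assms by (simp add: inner_cis_cis norm_mult)
  next
    case line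
    then obtain u where "w = (1 - u) *\<^sub>R (of_real R * cis (\<gamma> + pi/2)) + u *\<^sub>R (of_real R * cis (\<gamma> - pi/2))"
      by (auto simp: in_segment)
    then show ?thesis
      by (simp add: inner_add_right inner_cis_cis)
  qed
  then show "cis \<gamma> \<bullet> w \<ge> 0" "cmod w = R \<or> cis \<gamma> \<bullet> w = 0"
    by auto
qed

text \<open>Arc and diameter each contribute a positive real part, the arc less than 1 and the
  diameter less than 1/2. The only integer available for the sum is 1.\<close>

lemma winding_number_half_disc_path:
  assumes "cmod z < R" "cis \<gamma> \<bullet> z > 0"
  shows "winding_number (half_disc_path \<gamma> R) z = 1"
proof -
  have R: "R > 0" using assms(1) by (meson norm_ge_zero order.strict_trans1)
  let ?arc = "part_circlepath 0 R (\<gamma> - pi/2) (\<gamma> + pi/2)"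
  let ?a = "of_real R * cis (\<gamma> + pi/2)" and ?b = "of_real R * cis (\<gamma> - pi/2)"
  have z: "z \<notin> path_image (half_disc_path \<gamma> R)"
    using path_image_half_disc_path(2)[of R z \<gamma>] R assms by auto
  then have z_arc: "z \<notin> path_image ?arc" and z_line: "z \<notin> closed_segment ?a ?b"
    by (auto simp: half_disc_path_def path_image_join cis_conv_exp)
  have wn: "winding_number (half_disc_path \<gamma> R) z = winding_number ?arc z + winding_number (linepath ?a ?b) z"
    unfolding half_disc_path_def using z_arc z_line
    by (intro winding_number_join) (auto simp: cis_conv_exp)
  have "0 < Re (winding_number ?arc z)"
    using assms by (intro winding_number_part_circlepath_pos_less) auto
  moreover have "0 < Re (winding_number (linepath ?a ?b) z)"
  proof (rule winding_number_linepath_pos_lt)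
    have "cis (\<gamma> + pi/2) = \<i> * cis \<gamma>" "cis (\<gamma> - pi/2) = - \<i> * cis \<gamma>"
      by (simp_all add: complex_eq_iff cos_add sin_add cos_diff sin_diff)
    then have "Im ((?b - ?a) * cnj (?b - z)) = 2 * R * (cis \<gamma> \<bullet> z)"
      by (simp add: inner_complex_def algebra_simps)
    then show "0 < Im ((?b - ?a) * cnj (?b - z))"
      using R assms by simp
  qed
  \<comment> \<open>The ray from \<open>z\<close> in direction \<open>- cis \<gamma>\<close> misses
    the arc. A hit after length \<open>a\<close> would lie in the closed half-plane, hence
    \<open>a \<le> cis \<gamma> \<bullet> z\<close>; but up to that length the modulus does not
    exceed \<open>cmod z\<close>, which is less than \<open>R\<close>.\<close>
  moreover have "Re (winding_number ?arc z) < 1"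
  proof (rule winding_number_less_1[where w = "z - cis \<gamma>"])
    fix a :: real assume a: "a > 0"
    show "z + of_real a * ((z - cis \<gamma>) - z) \<notin> path_image ?arc"
    proof
      let ?w = "z - of_real a * cis \<gamma>"
      assume "z + of_real a * ((z - cis \<gamma>) - z) \<in> path_image ?arc"
      then have w: "?w \<in> path_image ?arc" by simp
      then have norm: "cmod ?w = R"
        using R in_path_image_part_circlepath[of ?w 0 R] by auto
      have "?w \<in> path_image (half_disc_path \<gamma> R)"
        using w by (auto simp: half_disc_path_def path_image_join cis_conv_exp)
      then have "cis \<gamma> \<bullet> ?w \<ge> 0"
        by (rule path_image_half_disc_path(1)[OF less_imp_le[OF R]])
      then have "cis \<gamma> \<bullet> z \<ge> a"
        using inner_cis_cis[of \<gamma> a \<gamma>] by (simp add: inner_diff_right)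
      have "(cmod ?w)\<^sup>2 = (cmod z)\<^sup>2 - 2 * a * (cis \<gamma> \<bullet> z) + a\<^sup>2"
      proof -
        have "(x - a * c)\<^sup>2 + (y - a * s)\<^sup>2 = x\<^sup>2 + y\<^sup>2 - 2 * a * (c * x + s * y) + a\<^sup>2 * (s\<^sup>2 + c\<^sup>2)"
          for x y c s :: real
          by algebra
        from this[of "Re z" "cos \<gamma>" "Im z" "sin \<gamma>"] show ?thesis
          unfolding cmod_power2 by (simp add: inner_complex_def)
      qed
      also have "\<dots> \<le> (cmod z)\<^sup>2 - 2 * a * a + a\<^sup>2"
        using mult_left_mono[OF \<open>cis \<gamma> \<bullet> z \<ge> a\<close>, of "2 * a"] a by simp
      also have "\<dots> \<le> (cmod z)\<^sup>2"
        by (simp add: power2_eq_square)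
      also have "\<dots> < R\<^sup>2"
        using assms(1) by (intro power_strict_mono) auto
      finally show False using norm by simp
    qed
  qed (use z_arc in auto)
  moreover have "\<bar>Re (winding_number (linepath ?a ?b) z)\<bar> < 1/2"
    using z_line by (rule winding_number_lt_half_linepath)
  ultimately show ?thesis
    using z wn by (intro winding_number_eq_1) auto
qed

lemma has_contour_integral_ray:
  fixes F :: "complex \<Rightarrow> complex"
  assumes R: "R > 0" and cont: "continuous_on {0..R} (\<lambda>t. F (of_real t * c))"
  shows "(F has_contour_integral integral {0..R} (\<lambda>t. F (of_real t * c) * c)) (linepath 0 (of_real R * c))"
proof -
  let ?h = "\<lambda>t. F (of_real t * c) * c"
  have "continuous_on {0..R} ?h"
    by (intro continuous_intros cont)
  then have "(?h has_integral integral {0..R} ?h) {0..R}"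
    by (intro integrable_integral integrable_continuous_real)
  from has_integral_stretch_real[OF this, of R]
  have "((\<lambda>x. ?h (R * x)) has_integral (1 / R) *\<^sub>R integral {0..R} ?h) ((\<lambda>x. x / R) ` {0..R})"
    using R by simp
  also have "(\<lambda>x. x / R) ` {0..R} = {0..1}"
    using R by (simp add: image_divide_atLeastAtMost)
  finally have "((\<lambda>x. R *\<^sub>R ?h (R * x)) has_integral R *\<^sub>R ((1 / R) *\<^sub>R integral {0..R} ?h)) {0..1}"
    by (rule has_integral_cmul)
  then show ?thesis
    unfolding has_contour_integral_linepath using R
    by (simp add: linepath_def scaleR_conv_of_real mult_ac)
qed

text \<open>The integrand \<open>1 / ((s powr \<alpha> - 1) * (s - p))\<close> pulled back to the ray \<open>s = t * cis \<beta>\<close>.\<close>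

definition ray_integrand :: "real \<Rightarrow> complex \<Rightarrow> real \<Rightarrow> real \<Rightarrow> complex" where
  "ray_integrand \<alpha> p \<beta> t = cis \<beta> /
     ((complex_of_real (t powr \<alpha>) * cis (\<alpha> * \<beta>) - 1) * (complex_of_real t * cis \<beta> - p))"

section \<open>Residue evaluation on a half-plane\<close>

context
  fixes \<alpha> \<gamma> :: real and p :: complex
  assumes \<alpha>: "1 < \<alpha>" "\<alpha> < 2" and \<gamma>: "\<bar>\<gamma>\<bar> < pi / 2"
    and p: "p \<noteq> 1" "cis \<gamma> \<bullet> p \<noteq> 0"
begin

lemma half_disc_path_avoids:
  assumes "1 < R" "cmod p < R" "w \<in> path_image (half_disc_path \<gamma> R)"
  shows "w \<noteq> 1" "w \<noteq> p" "cis \<gamma> \<bullet> w \<ge> 0"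
proof -
  have "cos \<gamma> > 0"
    using \<gamma> by (intro cos_gt_zero_pi) auto
  then have "cis \<gamma> \<bullet> 1 \<noteq> 0"
    by (simp add: inner_complex_def)
  then show "w \<noteq> 1" "w \<noteq> p" "cis \<gamma> \<bullet> w \<ge> 0"
    using path_image_half_disc_path[OF _ assms(3)] assms p by auto
qed

text \<open>Splitting \<open>1 / ((s - 1) * (s - p))\<close> leaves two integrands with one simple
  pole each, so that Cauchy's formula applies to each of them separately.\<close>

lemma unit_quot_partial_fraction:
  assumes "s \<noteq> 1" "s \<noteq> p"
  shows "1 / ((s powr complex_of_real \<alpha> - 1) * (s - p))
    = 1 / (1 - p) * (unit_quot \<alpha> s / (s - 1) - unit_quot \<alpha> s / (s - p))"
proof -
  have "s powr complex_of_real \<alpha> \<noteq> 1"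
    using powr_complex_eq_1_iff[of \<alpha> s] \<alpha> assms by simp
  then show ?thesis
    using assms p by (simp add: unit_quot_def divide_simps)
qed

lemma has_contour_integral_half_disc:
  assumes R: "1 < R" "cmod p < R"
  shows "((\<lambda>s. 1 / ((s powr complex_of_real \<alpha> - 1) * (s - p))) has_contour_integral
      2 * pi * \<i> / (1 - p) * (1 / complex_of_real \<alpha> - (if cis \<gamma> \<bullet> p > 0 then unit_quot \<alpha> p else 0)))
      (half_disc_path \<gamma> R)"
proof -
  let ?S = "{s. cis \<gamma> \<bullet> s \<ge> 0}" and ?P = "half_disc_path \<gamma> R"
  have S: "convex ?S" "interior ?S = {s. cis \<gamma> \<bullet> s > 0}"
    by (simp_all add: convex_halfspace_ge)
  note avoid = half_disc_path_avoids[OF R]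
  \<comment> \<open>The weak form of Cauchy's formula asks for continuity on the closed half-plane
    and differentiability in its interior, so the branch point 0 on the boundary does no
    harm.\<close>
  have inside: "((\<lambda>s. unit_quot \<alpha> s / (s - z)) has_contour_integral 2 * pi * \<i> * unit_quot \<alpha> z) ?P"
    if z: "cmod z < R" "cis \<gamma> \<bullet> z > 0" "z \<notin> path_image ?P" for z
  proof -
    have "((\<lambda>s. unit_quot \<alpha> s / (s - z)) has_contour_integral 2 * pi * \<i> * winding_number ?P z * unit_quot \<alpha> z) ?P"
      by (rule Cauchy_integral_formula_weak[where S = ?S and k = "{}"])
        (use S z avoid continuous_on_unit_quot[of \<alpha> \<gamma>] unit_quot_differentiable[of \<alpha> \<gamma>] \<alpha> \<gamma> in auto)
    then show ?thesis
      using winding_number_half_disc_path z by simp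
  qed
  have at_1: "((\<lambda>s. unit_quot \<alpha> s / (s - 1)) has_contour_integral 2 * pi * \<i> * unit_quot \<alpha> 1) ?P"
  proof (rule inside)
    have "cos \<gamma> > 0"
      using \<gamma> by (intro cos_gt_zero_pi) auto
    then show "cis \<gamma> \<bullet> 1 > 0"
      by (simp add: inner_complex_def)
  qed (use R avoid in auto)
  have at_p: "((\<lambda>s. unit_quot \<alpha> s / (s - p)) has_contour_integral
      2 * pi * \<i> * (if cis \<gamma> \<bullet> p > 0 then unit_quot \<alpha> p else 0)) ?P"
  proof (cases "cis \<gamma> \<bullet> p > 0")
    case True
    then show ?thesis
      using inside[of p] R avoid(2) by auto
  next
    case False
    \<comment> \<open>Here \<open>p\<close> lies strictly outside the closed half-plane, so the
      kernel has no singularity in it and contributes 0.\<close>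
    then have out: "s \<noteq> p" if "cis \<gamma> \<bullet> s \<ge> 0" for s
      using that p by auto
    have "((\<lambda>s. unit_quot \<alpha> s / (s - p)) has_contour_integral 0) ?P"
    proof (rule Cauchy_theorem_convex[where S = ?S and K = "{}"])
      show "continuous_on ?S (\<lambda>s. unit_quot \<alpha> s / (s - p))"
        using out \<alpha> \<gamma> by (intro continuous_on_divide continuous_on_unit_quot continuous_on_diff
            continuous_on_id continuous_on_const) auto
      show "(\<lambda>s. unit_quot \<alpha> s / (s - p)) field_differentiable at s" if "s \<in> interior ?S - {}" for s
        using that out[of s] \<alpha> \<gamma> S(2)
        by (intro field_differentiable_divide unit_quot_differentiable field_differentiable_diff
            field_differentiable_ident field_differentiable_const) auto
    qed (use S avoid in auto)
    then show ?thesis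
      using False by simp
  qed
  have "((\<lambda>s. 1 / (1 - p) * (unit_quot \<alpha> s / (s - 1) - unit_quot \<alpha> s / (s - p))) has_contour_integral
      1 / (1 - p) * (2 * pi * \<i> * unit_quot \<alpha> 1 - 2 * pi * \<i> * (if cis \<gamma> \<bullet> p > 0 then unit_quot \<alpha> p else 0))) ?P"
    by (intro has_contour_integral_lmul has_contour_integral_diff at_1 at_p)
  from has_contour_integral_eq[OF this unit_quot_partial_fraction[OF avoid(1,2), symmetric]]
  have "((\<lambda>s. 1 / ((s powr complex_of_real \<alpha> - 1) * (s - p))) has_contour_integral
      1 / (1 - p) * (2 * pi * \<i> * unit_quot \<alpha> 1 - 2 * pi * \<i> * (if cis \<gamma> \<bullet> p > 0 then unit_quot \<alpha> p else 0))) ?P" .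
  moreover have "1 / (1 - p) * (2 * pi * \<i> * unit_quot \<alpha> 1 - 2 * pi * \<i> * (if cis \<gamma> \<bullet> p > 0 then unit_quot \<alpha> p else 0))
      = 2 * pi * \<i> / (1 - p) * (1 / complex_of_real \<alpha> - (if cis \<gamma> \<bullet> p > 0 then unit_quot \<alpha> p else 0))"
    by (simp add: unit_quot_def right_diff_distrib)
  ultimately show ?thesis by (simp only:)
qed

text \<open>Length of the arc times the maximum of the integrand. A real exponent gives
  \<open>cmod (s powr \<alpha>) = R powr \<alpha>\<close>, so the bound decays like
  \<open>R powr (- \<alpha>)\<close> as \<open>R\<close> grows.\<close>

lemma arc_integral_le:
  assumes R: "1 < R" "cmod p < R"
    and int: "(\<lambda>s. 1 / ((s powr complex_of_real \<alpha> - 1) * (s - p))) contour_integrable_on part_circlepath 0 R a b"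
  shows "cmod (contour_integral (part_circlepath 0 R a b) (\<lambda>s. 1 / ((s powr complex_of_real \<alpha> - 1) * (s - p))))
    \<le> 1 / ((R powr \<alpha> - 1) * (R - cmod p)) * R * \<bar>b - a\<bar>"
proof (rule contour_integral_bound_part_circlepath[OF int])
  have R\<alpha>: "R powr \<alpha> > 1"
    using R \<alpha> by (simp add: gr_one_powr)
  then show "1 / ((R powr \<alpha> - 1) * (R - cmod p)) \<ge> 0" "R \<ge> 0"
    using R by simp_all
  fix s assume "s \<in> path_image (part_circlepath 0 R a b)"
  then have s: "cmod s = R"
    using path_image_part_circlepath_subset'[of R 0 a b] R by auto
  have "R powr \<alpha> - 1 \<le> cmod (s powr complex_of_real \<alpha> - 1)"
    using norm_triangle_ineq2[of "s powr complex_of_real \<alpha>" 1] s by (simp add: norm_powr_real_powr')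
  moreover have "R - cmod p \<le> cmod (s - p)"
    using norm_triangle_ineq2[of s p] s by simp
  ultimately show "cmod (1 / ((s powr complex_of_real \<alpha> - 1) * (s - p))) \<le> 1 / ((R powr \<alpha> - 1) * (R - cmod p))"
    using R\<alpha> R unfolding norm_divide norm_mult norm_one
    by (intro divide_left_mono mult_mono mult_pos_pos) auto
qed

lemma continuous_on_half_plane_integrand:
  "continuous_on {s. cis \<gamma> \<bullet> s \<ge> 0 \<and> s \<noteq> 1 \<and> s \<noteq> p} (\<lambda>s. 1 / ((s powr complex_of_real \<alpha> - 1) * (s - p)))"
proof -
  \<comment> \<open>This form of avoiding the branch cut admits \<open>s = 0\<close>, where
    continuity of the power rests on the positive exponent.\<close>
  have "Re s \<ge> 0 \<or> Im s \<noteq> 0" if "cis \<gamma> \<bullet> s \<ge> 0" for s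
    using half_plane_subset_slit[OF \<gamma> that] by (cases "s = 0") (auto simp: complex_nonpos_Reals_iff)
  then show ?thesis
    using \<alpha> powr_complex_eq_1_iff[of \<alpha>] by (intro continuous_intros) auto
qed

text \<open>The ray lies on the line \<open>cis \<gamma> \<bullet> s = 0\<close>, which contains
  neither 1 nor \<open>p\<close>. Both choices of \<open>\<beta>\<close> are principal arguments, so
  the power on the ray is explicit.\<close>

lemma has_contour_integral_boundary_ray:
  assumes R: "R > 0" and \<beta>: "\<beta> = \<gamma> - pi/2 \<or> \<beta> = \<gamma> + pi/2"
  shows "((\<lambda>s. 1 / ((s powr complex_of_real \<alpha> - 1) * (s - p))) has_contour_integral
      integral {0..R} (ray_integrand \<alpha> p \<beta>)) (linepath 0 (of_real R * cis \<beta>))"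
proof -
  let ?F = "\<lambda>s. 1 / ((s powr complex_of_real \<alpha> - 1) * (s - p))"
  have "cos \<gamma> > 0"
    using \<gamma> by (intro cos_gt_zero_pi) auto
  then have "cis \<gamma> \<bullet> 1 \<noteq> 0"
    by (simp add: inner_complex_def)
  moreover have inner: "cis \<gamma> \<bullet> (of_real t * cis \<beta>) = 0" for t
    using \<beta> by (auto simp: inner_cis_cis)
  ultimately have "of_real t * cis \<beta> \<noteq> 1" "of_real t * cis \<beta> \<noteq> p" for t
    using p by metis+
  with inner have "(\<lambda>t. of_real t * cis \<beta>) ` {0..R} \<subseteq> {s. cis \<gamma> \<bullet> s \<ge> 0 \<and> s \<noteq> 1 \<and> s \<noteq> p}"
    by auto
  then have "continuous_on {0..R} (\<lambda>t. ?F (of_real t * cis \<beta>))"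
    by (intro continuous_on_compose2[OF continuous_on_half_plane_integrand] continuous_intros)
  from has_contour_integral_ray[OF R this]
  have "(?F has_contour_integral integral {0..R} (\<lambda>t. ?F (of_real t * cis \<beta>) * cis \<beta>)) (linepath 0 (of_real R * cis \<beta>))" .
  moreover have "- pi < \<beta>" "\<beta> \<le> pi"
    using \<beta> \<gamma> by linarith+
  then have "integral {0..R} (\<lambda>t. ?F (of_real t * cis \<beta>) * cis \<beta>) = integral {0..R} (ray_integrand \<alpha> p \<beta>)"
    by (intro integral_cong) (simp add: ray_integrand_def powr_of_real_mult_cis)
  ultimately show ?thesis by simp
qed

text \<open>The diameter is the ray at \<open>\<gamma> + pi/2\<close> traversed inwards followed by
  the ray at \<open>\<gamma> - pi/2\<close> traversed outwards. The deviation from the residue value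
  is then exactly the arc integral.\<close>

lemma half_disc_ray_integrals:
  assumes R: "1 < R" "cmod p < R"
  shows "cmod (integral {0..R} (ray_integrand \<alpha> p (\<gamma> - pi/2)) - integral {0..R} (ray_integrand \<alpha> p (\<gamma> + pi/2))
      - 2 * pi * \<i> / (1 - p) * (1 / complex_of_real \<alpha> - (if cis \<gamma> \<bullet> p > 0 then unit_quot \<alpha> p else 0)))
    \<le> 1 / ((R powr \<alpha> - 1) * (R - cmod p)) * R * pi"
proof -
  let ?F = "\<lambda>s. 1 / ((s powr complex_of_real \<alpha> - 1) * (s - p))"
  let ?arc = "part_circlepath 0 R (\<gamma> - pi/2) (\<gamma> + pi/2)"
  let ?a = "of_real R * cis (\<gamma> + pi/2)" and ?b = "of_real R * cis (\<gamma> - pi/2)"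
  let ?V = "2 * pi * \<i> / (1 - p) * (1 / complex_of_real \<alpha> - (if cis \<gamma> \<bullet> p > 0 then unit_quot \<alpha> p else 0))"
  let ?I = "\<lambda>\<beta>. integral {0..R} (ray_integrand \<alpha> p \<beta>)"
  have V: "(?F has_contour_integral ?V) (?arc +++ linepath ?a ?b)"
    using has_contour_integral_half_disc[OF R] unfolding half_disc_path_def .
  then have int: "?F contour_integrable_on (?arc +++ linepath ?a ?b)"
    by (rule has_contour_integral_integrable)
  have arc: "?F contour_integrable_on ?arc" and line: "?F contour_integrable_on linepath ?a ?b"
    using contour_integrable_joinD1[OF int] contour_integrable_joinD2[OF int] by auto
  have "contour_integral ?arc ?F + contour_integral (linepath ?a ?b) ?F = ?V"
    using contour_integral_unique[OF V] arc line by simp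
  moreover have "contour_integral (linepath ?a ?b) ?F = ?I (\<gamma> - pi/2) - ?I (\<gamma> + pi/2)"
  proof -
    have "closed_segment ?a ?b \<subseteq> {s. cis \<gamma> \<bullet> s \<ge> 0 \<and> s \<noteq> 1 \<and> s \<noteq> p}"
    proof
      fix s assume "s \<in> closed_segment ?a ?b"
      then have "s \<in> path_image (half_disc_path \<gamma> R)"
        by (auto simp: half_disc_path_def path_image_join cis_conv_exp)
      then show "s \<in> {s. cis \<gamma> \<bullet> s \<ge> 0 \<and> s \<noteq> 1 \<and> s \<noteq> p}"
        using half_disc_path_avoids[OF R] by simp
    qed
    then have cont: "continuous_on (closed_segment ?a ?b) ?F"
      by (rule continuous_on_subset[OF continuous_on_half_plane_integrand])
    \<comment> \<open>The origin is the midpoint of the diameter, which allows splitting the segment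
      there.\<close>
    have "?b = - ?a"
      by (simp add: complex_eq_iff cos_add sin_add cos_diff sin_diff)
    then have "0 = (1 - 1/2) *\<^sub>R ?a + (1/2) *\<^sub>R ?b"
      by simp
    then have "0 \<in> closed_segment ?a ?b"
      unfolding in_segment by (intro exI[of _ "1/2"]) auto
    then have "contour_integral (linepath ?a ?b) ?F = contour_integral (linepath ?a 0) ?F + contour_integral (linepath 0 ?b) ?F"
      by (rule contour_integral_split_linepath[OF cont])
    moreover have "contour_integral (linepath 0 ?b) ?F = ?I (\<gamma> - pi/2)"
      using R has_contour_integral_boundary_ray by (intro contour_integral_unique) auto
    moreover have "contour_integral (linepath ?a 0) ?F = - ?I (\<gamma> + pi/2)"
    proof (rule contour_integral_unique)
      have "(?F has_contour_integral ?I (\<gamma> + pi/2)) (linepath 0 ?a)"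
        using R has_contour_integral_boundary_ray by auto
      from has_contour_integral_reversepath[OF _ this]
      show "(?F has_contour_integral - ?I (\<gamma> + pi/2)) (linepath ?a 0)"
        by simp
    qed
    ultimately show ?thesis by simp
  qed
  ultimately have eq: "contour_integral ?arc ?F + (?I (\<gamma> - pi/2) - ?I (\<gamma> + pi/2)) = ?V"
    by (simp only:)
  have "?I (\<gamma> - pi/2) - ?I (\<gamma> + pi/2) - ?V = - contour_integral ?arc ?F"
    unfolding eq[symmetric] by (simp only: diff_add_eq_diff_diff_swap diff_self diff_0)
  then show ?thesis
    using arc_integral_le[OF R arc] by simp
qed

text \<open>Bridge from the gauge integrals over \<open>{0..R}\<close> that contour integration
  yields to Lebesgue integrals over the half-line.\<close>

lemma tendsto_integral_at_top_lborel:
  fixes f :: "real \<Rightarrow> complex"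
  assumes f: "set_integrable lborel {0..} f"
  shows "((\<lambda>R. integral {0..R} f) \<longlongrightarrow> (CLBINT t:{0..}. f t)) at_top"
proof -
  have "set_integrable lborel {0..R} f" for R
    using f by (rule set_integrable_subset) auto
  then have "(CLBINT t:{0..R}. f t) = integral {0..R} f" for R
    by (rule set_borel_integral_eq_integral)
  moreover have "((\<lambda>R. CLBINT t:{0..R}. f t) \<longlongrightarrow> (CLBINT t:{0..}. f t)) at_top"
    using f by (intro tendsto_set_lebesgue_integral_at_top) auto
  ultimately show ?thesis by simp
qed

text \<open>The limit of the half-disc estimate as \<open>R\<close> tends to infinity. The term
  \<open>1 / \<alpha>\<close> comes from the pole at 1, the other one from \<open>p\<close> when it
  lies in the half-plane.\<close>

lemma half_plane_ray_integrals:
  assumes int: "set_integrable lborel {0..} (ray_integrand \<alpha> p (\<gamma> - pi/2))"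
      "set_integrable lborel {0..} (ray_integrand \<alpha> p (\<gamma> + pi/2))"
  shows "(CLBINT t:{0..}. ray_integrand \<alpha> p (\<gamma> - pi/2) t) - (CLBINT t:{0..}. ray_integrand \<alpha> p (\<gamma> + pi/2) t)
    = 2 * pi * \<i> / (1 - p) * (1 / complex_of_real \<alpha> - (if cis \<gamma> \<bullet> p > 0 then unit_quot \<alpha> p else 0))"
proof (rule tendsto_unique)
  let ?V = "2 * pi * \<i> / (1 - p) * (1 / complex_of_real \<alpha> - (if cis \<gamma> \<bullet> p > 0 then unit_quot \<alpha> p else 0))"
  let ?D = "\<lambda>R. integral {0..R} (ray_integrand \<alpha> p (\<gamma> - pi/2)) - integral {0..R} (ray_integrand \<alpha> p (\<gamma> + pi/2))"
  show "(?D \<longlongrightarrow> (CLBINT t:{0..}. ray_integrand \<alpha> p (\<gamma> - pi/2) t) - (CLBINT t:{0..}. ray_integrand \<alpha> p (\<gamma> + pi/2) t)) at_top"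
    using int by (intro tendsto_diff tendsto_integral_at_top_lborel)
  have "((\<lambda>R. 1 / ((R powr \<alpha> - 1) * (R - cmod p)) * R * pi) \<longlongrightarrow> 0) at_top"
    using \<alpha> by real_asymp
  moreover have "\<forall>\<^sub>F R in at_top. cmod (?D R - ?V) \<le> 1 / ((R powr \<alpha> - 1) * (R - cmod p)) * R * pi"
    using eventually_gt_at_top[of "max 1 (cmod p)"]
    by eventually_elim (rule half_disc_ray_integrals, auto)
  ultimately have "((\<lambda>R. ?D R - ?V) \<longlongrightarrow> 0) at_top"
    by (rule Lim_null_comparison[rotated])
  then show "(?D \<longlongrightarrow> ?V) at_top"
    by (simp add: LIM_zero_iff)
qed simp

end

section \<open>The weights\<close>

text \<open>This is minus the imaginary part of
  \<open>1 / (t powr \<alpha> * cis \<phi> - 1)\<close>: the denominator is the squared modulus of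
  \<open>t powr \<alpha> * cis \<phi> - 1\<close>.\<close>

definition G_weight :: "real \<Rightarrow> real \<Rightarrow> real \<Rightarrow> real" where
  "G_weight \<alpha> \<phi> t = t powr \<alpha> * sin \<phi> / (t powr (2 * \<alpha>) - 2 * t powr \<alpha> * cos \<phi> + 1)"

text \<open>One integrable function that dominates, up to constants, the weights, the weights
  divided by \<open>t\<close>, and the ray integrands.\<close>

definition tail_majorant :: "real \<Rightarrow> real \<Rightarrow> real" where
  "tail_majorant \<alpha> t = (if t \<le> 1 then 1 else t powr (- \<alpha>))"

lemma set_integrable_tail_majorant:
  assumes "1 < \<alpha>"
  shows "set_integrable lborel {0..} (tail_majorant \<alpha>)"
proof -
  have "set_integrable lborel (einterval 1 \<infinity>) (\<lambda>t. t powr (- \<alpha>))"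
  proof (rule interval_integral_FTC_nonneg(1))
    let ?F = "\<lambda>t. t powr (1 - \<alpha>) / (1 - \<alpha>)"
    show "(?F has_real_derivative t powr (- \<alpha>)) (at t)" if "1 < ereal t" for t
      using that assms by (auto intro!: derivative_eq_intros simp: one_ereal_def)
    show "isCont (\<lambda>t. t powr (- \<alpha>)) t" if "1 < ereal t" for t
      using that by (intro continuous_intros) (auto simp: one_ereal_def)
    have "(?F \<longlongrightarrow> ?F 1) (at_right 1)"
      using assms by (intro tendsto_intros) auto
    then show "((?F \<circ> real_of_ereal) \<longlongrightarrow> ?F 1) (at_right 1)"
      by (simp add: one_ereal_def ereal_tendsto_simps)
    have "(?F \<longlongrightarrow> 0) at_top"
      using assms by real_asymp
    then show "((?F \<circ> real_of_ereal) \<longlongrightarrow> 0) (at_left \<infinity>)"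
      by (simp add: ereal_tendsto_simps)
  qed (use assms in auto)
  then have "set_integrable lborel {1<..} (\<lambda>t. t powr (- \<alpha>))"
    by (simp add: one_ereal_def)
  then have "set_integrable lborel {1<..} (tail_majorant \<alpha>)"
    by (rule set_integrable_cong[THEN iffD1, rotated 3]) (auto simp: tail_majorant_def)
  moreover have "set_integrable lborel {0..1 :: real} (\<lambda>t. 1 :: real)"
    by (rule borel_integrable_atLeastAtMost') (rule continuous_on_const)
  then have "set_integrable lborel {0..1} (tail_majorant \<alpha>)"
    by (rule set_integrable_cong[THEN iffD1, rotated 3]) (auto simp: tail_majorant_def)
  ultimately have "set_integrable lborel ({0..1} \<union> {1<..}) (tail_majorant \<alpha>)"
    by (intro set_integrable_Un) auto
  moreover have "{0..1} \<union> {1<..} = {0 :: real..}"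
    by auto
  ultimately show ?thesis by simp
qed

text \<open>For \<open>cos \<phi> \<ge> 0\<close> use \<open>2 * y \<le> y\<^sup>2 + 1\<close>;
  otherwise the cross term already has the good sign. The constant is positive exactly when
  \<open>cos \<phi> < 1\<close>, that is, when \<open>y * cis \<phi>\<close> cannot reach 1.\<close>

lemma unit_pole_denom_ge:
  fixes y \<phi> :: real
  assumes "y \<ge> 0"
  shows "y\<^sup>2 - 2 * y * cos \<phi> + 1 \<ge> (1 - max 0 (cos \<phi>)) * (1 + y\<^sup>2)"
proof (cases "cos \<phi> \<ge> 0")
  case True
  have "cos \<phi> * (2 * y) \<le> cos \<phi> * (y\<^sup>2 + 1)"
    using True sum_squares_bound[of y 1] by (intro mult_left_mono) auto
  then show ?thesis
    using True by (simp add: max_def algebra_simps)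
next
  case False
  then have "y * cos \<phi> \<le> 0"
    using assms by (intro mult_nonneg_nonpos) auto
  then show ?thesis
    using False by (simp add: max_def algebra_simps)
qed

lemma norm_unit_pole: "(cmod (complex_of_real y * cis \<phi> - 1))\<^sup>2 = y\<^sup>2 - 2 * y * cos \<phi> + 1"
proof -
  have "(y * c - 1)\<^sup>2 + (y * s)\<^sup>2 = y\<^sup>2 * (s\<^sup>2 + c\<^sup>2) - 2 * y * c + 1" for c s :: real
    by algebra
  from this[of "cos \<phi>" "sin \<phi>"] show ?thesis
    unfolding cmod_power2 by simp
qed

text \<open>The first bound serves the ray integrands, which involve the modulus of the denominator,
  and the second the weights, which involve its square. The second follows from the first by
  \<open>y \<le> sqrt (1 + y\<^sup>2)\<close>.\<close>

lemma tail_majorant_ge: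
  assumes t: "t > 0" and \<alpha>: "0 < \<alpha>"
  shows "1 / sqrt (1 + (t powr \<alpha>)\<^sup>2) \<le> tail_majorant \<alpha> t"
    and "t powr \<alpha> / (1 + (t powr \<alpha>)\<^sup>2) \<le> tail_majorant \<alpha> t"
proof -
  define y where "y = t powr \<alpha>"
  have y: "y > 0" using t by (simp add: y_def)
  have sq: "1 \<le> sqrt (1 + y\<^sup>2)" "y \<le> sqrt (1 + y\<^sup>2)"
    by (auto intro: real_le_rsqrt)
  have "y / (1 + y\<^sup>2) \<le> 1 / sqrt (1 + y\<^sup>2)"
  proof -
    have "y / (1 + y\<^sup>2) \<le> sqrt (1 + y\<^sup>2) / (1 + y\<^sup>2)"
      using sq by (intro divide_right_mono) auto
    also have "\<dots> = sqrt (1 + y\<^sup>2) / (sqrt (1 + y\<^sup>2) * sqrt (1 + y\<^sup>2))"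
      by (simp add: add_nonneg_nonneg)
    also have "\<dots> = 1 / sqrt (1 + y\<^sup>2)"
      using sq by (simp add: divide_simps)
    finally show ?thesis .
  qed
  moreover have "1 / sqrt (1 + y\<^sup>2) \<le> tail_majorant \<alpha> t"
  proof (cases "t \<le> 1")
    case True
    have "1 / sqrt (1 + y\<^sup>2) \<le> 1 / 1"
      by (intro divide_left_mono) (auto simp: add_pos_nonneg)
    then show ?thesis
      unfolding tail_majorant_def by (simp only: True if_True div_by_1)
  next
    case False
    have "1 / sqrt (1 + y\<^sup>2) \<le> 1 / y"
      using sq y by (intro divide_left_mono mult_pos_pos) (auto simp: add_pos_nonneg)
    then show ?thesis
      using False by (simp add: tail_majorant_def y_def powr_minus_divide)
  qed
  ultimately show "1 / sqrt (1 + (t powr \<alpha>)\<^sup>2) \<le> tail_majorant \<alpha> t"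
    and "t powr \<alpha> / (1 + (t powr \<alpha>)\<^sup>2) \<le> tail_majorant \<alpha> t"
    unfolding y_def by linarith+
qed

lemma powr_double: "t powr (2 * \<alpha>) = (t powr \<alpha>)\<^sup>2" for t :: real
  by (simp add: powr_add[symmetric] power2_eq_square)

lemma G_weight_measurable [measurable]: "G_weight \<alpha> \<phi> \<in> borel_measurable borel"
  unfolding G_weight_def by measurable

lemma G_weight_bounds:
  assumes t: "t > 0" and \<alpha>: "1 < \<alpha>" and \<phi>: "0 < \<phi>" "\<phi> \<le> pi"
  shows "0 \<le> G_weight \<alpha> \<phi> t"
    and "G_weight \<alpha> \<phi> t \<le> 1 / (1 - max 0 (cos \<phi>)) * tail_majorant \<alpha> t"
    and "G_weight \<alpha> \<phi> t / t \<le> 1 / (1 - max 0 (cos \<phi>)) * tail_majorant \<alpha> t"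
proof -
  define y where "y = t powr \<alpha>"
  define k where "k = 1 - max 0 (cos \<phi>)"
  have y: "y > 0" using t by (simp add: y_def)
  have sin: "0 \<le> sin \<phi>" "sin \<phi> \<le> 1"
    using \<phi> by (auto intro: sin_ge_zero)
  have k: "k > 0"
    using cos_monotone_0_pi[of 0 \<phi>] \<phi> by (simp add: k_def)
  have den: "k * (1 + y\<^sup>2) \<le> y\<^sup>2 - 2 * y * cos \<phi> + 1"
    unfolding k_def using y by (intro unit_pole_denom_ge) simp
  have pos: "k * (1 + y\<^sup>2) > 0"
    using k by (simp add: add_pos_nonneg)
  have w: "G_weight \<alpha> \<phi> t = y * sin \<phi> / (y\<^sup>2 - 2 * y * cos \<phi> + 1)"
    by (simp add: G_weight_def y_def powr_double)
  show "0 \<le> G_weight \<alpha> \<phi> t"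
    unfolding w using y sin den pos by (intro divide_nonneg_nonneg mult_nonneg_nonneg) linarith+
  have le: "G_weight \<alpha> \<phi> t \<le> 1 / k * (y / (1 + y\<^sup>2))"
  proof -
    have "G_weight \<alpha> \<phi> t \<le> y * 1 / (k * (1 + y\<^sup>2))"
      unfolding w using y sin den pos by (intro frac_le mult_left_mono mult_nonneg_nonneg) auto
    then show ?thesis by simp
  qed
  also have "\<dots> \<le> 1 / k * tail_majorant \<alpha> t"
    using tail_majorant_ge(2)[OF t, of \<alpha>] \<alpha> k unfolding y_def by (intro mult_left_mono) auto
  finally show bound: "G_weight \<alpha> \<phi> t \<le> 1 / (1 - max 0 (cos \<phi>)) * tail_majorant \<alpha> t"
    unfolding k_def .
  show "G_weight \<alpha> \<phi> t / t \<le> 1 / (1 - max 0 (cos \<phi>)) * tail_majorant \<alpha> t"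
  proof (cases "t \<le> 1")
    case True
    \<comment> \<open>Near 0 the condition \<open>\<alpha> > 1\<close> makes the weight vanish at
      least linearly, so division by \<open>t\<close> keeps it bounded.\<close>
    have "y \<le> t"
      using powr_mono'[of 1 \<alpha> t] True t \<alpha> by (simp add: y_def)
    have "y / (1 + y\<^sup>2) \<le> y / 1"
      using y by (intro divide_left_mono) (auto simp: add_pos_nonneg)
    also have "\<dots> \<le> t"
      using \<open>y \<le> t\<close> by simp
    finally have "y / (1 + y\<^sup>2) \<le> t" .
    then have "1 / k * (y / (1 + y\<^sup>2)) \<le> 1 / k * t"
      using k by (intro mult_left_mono) auto
    with le have "G_weight \<alpha> \<phi> t \<le> 1 / k * t"
      by linarith
    then have "G_weight \<alpha> \<phi> t / t \<le> 1 / k"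
      using t by (simp add: pos_divide_le_eq)
    then show ?thesis
      using True by (simp add: k_def tail_majorant_def)
  next
    case False
    then have "G_weight \<alpha> \<phi> t / t \<le> G_weight \<alpha> \<phi> t / 1"
      using \<open>0 \<le> G_weight \<alpha> \<phi> t\<close> by (intro divide_left_mono) auto
    then show ?thesis
      using bound by simp
  qed
qed

lemma
  assumes \<alpha>: "1 < \<alpha>" and \<phi>: "0 < \<phi>" "\<phi> \<le> pi"
  shows set_integrable_G_weight: "set_integrable lborel {0<..} (G_weight \<alpha> \<phi>)"
    and set_integrable_G_weight_div: "set_integrable lborel {0<..} (\<lambda>t. G_weight \<alpha> \<phi> t / t)"
proof -
  let ?m = "\<lambda>t. 1 / (1 - max 0 (cos \<phi>)) * tail_majorant \<alpha> t"
  have m: "set_integrable lborel {0<..} ?m"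
    using set_integrable_tail_majorant[OF \<alpha>]
    by (intro set_integrable_mult_right) (rule set_integrable_subset, auto)
  show "set_integrable lborel {0<..} (G_weight \<alpha> \<phi>)"
  proof (rule set_integrable_bound[OF m])
    show "set_borel_measurable lborel {0<..} (G_weight \<alpha> \<phi>)"
      unfolding set_borel_measurable_def by measurable
    show "AE t in lborel. t \<in> {0<..} \<longrightarrow> norm (G_weight \<alpha> \<phi> t) \<le> norm (?m t)"
    proof (intro AE_I2 impI)
      fix t :: real assume "t \<in> {0<..}"
      then have "t > 0" by simp
      from G_weight_bounds(1,2)[OF this \<alpha> \<phi>] show "norm (G_weight \<alpha> \<phi> t) \<le> norm (?m t)"
        unfolding real_norm_def by linarith
    qed
  qed
  show "set_integrable lborel {0<..} (\<lambda>t. G_weight \<alpha> \<phi> t / t)"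
  proof (rule set_integrable_bound[OF m])
    show "set_borel_measurable lborel {0<..} (\<lambda>t. G_weight \<alpha> \<phi> t / t)"
      unfolding set_borel_measurable_def by measurable
    show "AE t in lborel. t \<in> {0<..} \<longrightarrow> norm (G_weight \<alpha> \<phi> t / t) \<le> norm (?m t)"
    proof (intro AE_I2 impI)
      fix t :: real assume "t \<in> {0<..}"
      then have t: "t > 0" by simp
      have "0 \<le> G_weight \<alpha> \<phi> t / t"
        using G_weight_bounds(1)[OF t \<alpha> \<phi>] t by simp
      with G_weight_bounds(3)[OF t \<alpha> \<phi>] show "norm (G_weight \<alpha> \<phi> t / t) \<le> norm (?m t)"
        unfolding real_norm_def by linarith
    qed
  qed
qed

section \<open>Weights as differences of ray integrands\<close>

lemma ray_integrand_eq:
  assumes "p = z * cis \<beta>"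
  shows "ray_integrand \<alpha> p \<beta> t = 1 / ((complex_of_real (t powr \<alpha>) * cis (\<alpha> * \<beta>) - 1) * (complex_of_real t - z))"
proof -
  have "complex_of_real t * cis \<beta> - p = cis \<beta> * (complex_of_real t - z)"
    using assms by (simp add: algebra_simps)
  then show ?thesis
    by (simp add: ray_integrand_def)
qed

text \<open>In the variable \<open>t\<close> the pole sits at \<open>z\<close>, at distance at least
  \<open>\<bar>Im z\<bar>\<close> from the real axis. That factor is bounded below, and the factor
  with the power supplies the decay.\<close>

lemma set_integrable_ray_integrand:
  assumes \<alpha>: "1 < \<alpha>" and cos: "cos (\<alpha> * \<beta>) < 1" and p: "p = z * cis \<beta>"
    and z: "Re z = 0" "Im z \<noteq> 0"
  shows "set_integrable lborel {0..} (ray_integrand \<alpha> p \<beta>)"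
proof -
  define k where "k = 1 - max 0 (cos (\<alpha> * \<beta>))"
  have k: "k > 0"
    using cos by (simp add: k_def)
  let ?m = "\<lambda>t. 1 / (sqrt k * \<bar>Im z\<bar>) * tail_majorant \<alpha> t"
  have "set_integrable lborel {0..} ?m"
    using set_integrable_tail_majorant[OF \<alpha>] by (intro set_integrable_mult_right)
  then show ?thesis
  proof (rule set_integrable_bound)
    show "set_borel_measurable lborel {0..} (ray_integrand \<alpha> p \<beta>)"
      unfolding set_borel_measurable_def ray_integrand_def by measurable
    show "AE t in lborel. t \<in> {0..} \<longrightarrow> norm (ray_integrand \<alpha> p \<beta> t) \<le> norm (?m t)"
      using AE_lborel_singleton[of 0]
    proof (eventually_elim, intro impI)
      fix t :: real assume "t \<noteq> 0" "t \<in> {0..}"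
      then have t: "t > 0" by simp
      define y where "y = t powr \<alpha>"
      have "sqrt (k * (1 + y\<^sup>2)) \<le> sqrt ((cmod (complex_of_real y * cis (\<alpha> * \<beta>) - 1))\<^sup>2)"
        unfolding norm_unit_pole k_def by (intro real_sqrt_le_mono unit_pole_denom_ge) (simp add: y_def)
      then have 1: "sqrt k * sqrt (1 + y\<^sup>2) \<le> cmod (complex_of_real y * cis (\<alpha> * \<beta>) - 1)"
        by (simp add: real_sqrt_mult)
      have 2: "\<bar>Im z\<bar> \<le> cmod (complex_of_real t - z)"
        using abs_Im_le_cmod[of "complex_of_real t - z"] by simp
      have pos: "0 < sqrt k * sqrt (1 + y\<^sup>2)"
        using k by (simp add: add_pos_nonneg)
      have "norm (ray_integrand \<alpha> p \<beta> t) \<le> 1 / ((sqrt k * sqrt (1 + y\<^sup>2)) * \<bar>Im z\<bar>)"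
        unfolding ray_integrand_eq[OF p] norm_divide norm_mult norm_one y_def[symmetric]
      proof (rule frac_le)
        show "0 < sqrt k * sqrt (1 + y\<^sup>2) * \<bar>Im z\<bar>"
          using pos z by simp
        show "sqrt k * sqrt (1 + y\<^sup>2) * \<bar>Im z\<bar>
            \<le> cmod (complex_of_real y * cis (\<alpha> * \<beta>) - 1) * cmod (complex_of_real t - z)"
          using 1 2 by (rule mult_mono) simp_all
      qed simp_all
      also have "\<dots> = 1 / (sqrt k * \<bar>Im z\<bar>) * (1 / sqrt (1 + y\<^sup>2))"
        by simp
      also have "\<dots> \<le> ?m t"
        using tail_majorant_ge(1)[OF t, of \<alpha>] \<alpha> k unfolding y_def by (intro mult_left_mono) auto
      finally show "norm (ray_integrand \<alpha> p \<beta> t) \<le> norm (?m t)"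
        unfolding real_norm_def by linarith
    qed
  qed
qed

text \<open>With \<open>u = t powr \<alpha> * cis (\<alpha> * \<beta>) - 1\<close> the weight is
  \<open>(1 / cnj u - 1 / u) / (2 * \<i>)\<close>, and \<open>cnj u\<close> belongs to the conjugate
  ray. The common pole \<open>z\<close> in \<open>t\<close> is rotated to \<open>p\<close> on one
  ray and to \<open>q\<close> on the other.\<close>

lemma G_weight_eq_ray_integrands:
  assumes cos: "cos (\<alpha> * \<beta>) < 1" and p: "p = z * cis \<beta>" and q: "q = z * cis (- \<beta>)"
  shows "complex_of_real (G_weight \<alpha> (\<alpha> * \<beta>) t) / (complex_of_real t - z)
    = 1 / (2 * \<i>) * (ray_integrand \<alpha> q (- \<beta>) t - ray_integrand \<alpha> p \<beta> t)"
proof -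
  let ?s = "complex_of_real (t powr \<alpha>) * cis (\<alpha> * \<beta>) - 1"
  have cnj: "cnj ?s = complex_of_real (t powr \<alpha>) * cis (\<alpha> * - \<beta>) - 1"
    by (simp add: cis_cnj)
  have norm: "(cmod ?s)\<^sup>2 = t powr (2 * \<alpha>) - 2 * t powr \<alpha> * cos (\<alpha> * \<beta>) + 1"
    by (simp add: norm_unit_pole powr_double)
  have "0 < (1 - max 0 (cos (\<alpha> * \<beta>))) * (1 + (t powr \<alpha>)\<^sup>2)"
    using cos by (intro mult_pos_pos) (auto simp: add_pos_nonneg)
  also have "\<dots> \<le> (cmod ?s)\<^sup>2"
    unfolding norm_unit_pole by (intro unit_pole_denom_ge) simp
  finally have s: "?s \<noteq> 0" by auto
  have "1 / cnj u - 1 / u = 2 * \<i> * complex_of_real (Im u) / complex_of_real ((cmod u)\<^sup>2)" if "u \<noteq> 0" for u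
  proof -
    have "1 / cnj u - 1 / u = (u - cnj u) / (u * cnj u)"
      using that by (simp add: diff_frac_eq mult.commute)
    then show ?thesis
      unfolding complex_norm_square by (simp add: complex_diff_cnj mult_ac)
  qed
  from this[OF s] have "1 / cnj ?s - 1 / ?s = 2 * \<i> * complex_of_real (Im ?s) / complex_of_real ((cmod ?s)\<^sup>2)" .
  also have "\<dots> = 2 * \<i> * complex_of_real (G_weight \<alpha> (\<alpha> * \<beta>) t)"
    unfolding norm G_weight_def by simp
  finally have "complex_of_real (G_weight \<alpha> (\<alpha> * \<beta>) t) = 1 / (2 * \<i>) * (1 / cnj ?s - 1 / ?s)"
    by simp
  moreover have "g / d = 1 / (2 * \<i>) * (1 / (a * d) - 1 / (b * d))"
    if "g = 1 / (2 * \<i>) * (1 / a - 1 / b)" for g a b d :: complex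
    unfolding that by (simp add: diff_divide_distrib right_diff_distrib mult_ac)
  ultimately show ?thesis
    unfolding ray_integrand_eq[OF p] ray_integrand_eq[OF q] cnj by blast
qed

section \<open>The Fourier transform\<close>

text \<open>Reflecting the negative half-line onto the positive one changes the sign of
  \<open>\<xi>\<close>. The value 0 at the origin makes the splitting hold pointwise.\<close>

lemma fourier_two_sided:
  fixes H h\<^sub>1 h\<^sub>2 :: "real \<Rightarrow> real" and \<xi> :: real
  assumes H: "H 0 = 0" "\<And>x. x > 0 \<Longrightarrow> H x = h\<^sub>1 x" "\<And>x. x > 0 \<Longrightarrow> H (- x) = h\<^sub>2 x"
    and h\<^sub>1: "set_integrable lborel {0<..} (\<lambda>x. complex_of_real (h\<^sub>1 x) * exp (- (\<i> * complex_of_real \<xi> * complex_of_real x)))"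
    and h\<^sub>2: "set_integrable lborel {0<..} (\<lambda>x. complex_of_real (h\<^sub>2 x) * exp (- (\<i> * complex_of_real (- \<xi>) * complex_of_real x)))"
  shows "complex_integrable lborel (\<lambda>x. complex_of_real (H x) * exp (- (\<i> * complex_of_real \<xi> * complex_of_real x)))"
    and "fourier (\<lambda>x. complex_of_real (H x)) \<xi>
      = (CLBINT x:{0<..}. complex_of_real (h\<^sub>1 x) * exp (- (\<i> * complex_of_real \<xi> * complex_of_real x)))
      + (CLBINT x:{0<..}. complex_of_real (h\<^sub>2 x) * exp (- (\<i> * complex_of_real (- \<xi>) * complex_of_real x)))"
proof -
  define A where "A x = indicator {0<..} x *\<^sub>R (complex_of_real (h\<^sub>1 x) * exp (- (\<i> * complex_of_real \<xi> * complex_of_real x)))" for x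
  define B where "B x = indicator {0<..} x *\<^sub>R (complex_of_real (h\<^sub>2 x) * exp (- (\<i> * complex_of_real (- \<xi>) * complex_of_real x)))" for x
  have A: "integrable lborel A" and B: "integrable lborel B"
    using h\<^sub>1 h\<^sub>2 unfolding set_integrable_def A_def B_def .
  have B': "integrable lborel (\<lambda>x. B (- x))"
    using lborel_integrable_real_affine_iff[of "-1" B 0] B by simp
  have eq: "complex_of_real (H x) * exp (- (\<i> * complex_of_real \<xi> * complex_of_real x)) = A x + B (- x)" for x
  proof -
    consider "x = 0" | "x > 0" | "x < 0" by linarith
    then show ?thesis
      by cases (use H(1) H(2)[of x] H(3)[of "- x"] in \<open>simp_all add: A_def B_def\<close>)
  qed
  show "complex_integrable lborel (\<lambda>x. complex_of_real (H x) * exp (- (\<i> * complex_of_real \<xi> * complex_of_real x)))"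
    unfolding eq using A B' by (rule Bochner_Integration.integrable_add)
  have "fourier (\<lambda>x. complex_of_real (H x)) \<xi> = integral\<^sup>L lborel A + (CLBINT x. B (- x))"
    unfolding fourier_def eq using A B' by (rule Bochner_Integration.integral_add)
  also have "(CLBINT x. B (- x)) = integral\<^sup>L lborel B"
    using lborel_integral_real_affine[of "-1" B 0] by simp
  finally show "fourier (\<lambda>x. complex_of_real (H x)) \<xi>
      = (CLBINT x:{0<..}. complex_of_real (h\<^sub>1 x) * exp (- (\<i> * complex_of_real \<xi> * complex_of_real x)))
      + (CLBINT x:{0<..}. complex_of_real (h\<^sub>2 x) * exp (- (\<i> * complex_of_real (- \<xi>) * complex_of_real x)))"
    unfolding set_lebesgue_integral_def A_def B_def .
qed

lemma fourier_reflect: "fourier (\<lambda>x. f (- x)) (- \<xi>) = fourier f \<xi>"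
  unfolding fourier_def
  using lborel_integral_real_affine[of "-1" "\<lambda>x. f x * exp (- (\<i> * complex_of_real \<xi> * complex_of_real x))" 0] by simp

lemma isCont_fourier:
  assumes f: "complex_integrable lborel f"
  shows "isCont (fourier f) \<xi>"
  unfolding isCont_def tendsto_at_iff_sequentially comp_def
proof (intro allI impI)
  fix X :: "nat \<Rightarrow> real" assume X: "X \<longlonglongrightarrow> \<xi>"
  have [measurable]: "f \<in> borel_measurable borel"
    using f by simp
  show "(\<lambda>n. fourier f (X n)) \<longlonglongrightarrow> fourier f \<xi>"
    unfolding fourier_def
  proof (rule integral_dominated_convergence)
    show "integrable lborel (\<lambda>x. norm (f x))"
      using f by (rule integrable_norm)
    show "AE x in lborel. (\<lambda>n. f x * exp (- (\<i> * complex_of_real (X n) * complex_of_real x)))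
        \<longlonglongrightarrow> f x * exp (- (\<i> * complex_of_real \<xi> * complex_of_real x))"
      by (intro AE_I2 tendsto_intros X)
    show "AE x in lborel. norm (f x * exp (- (\<i> * complex_of_real (X n) * complex_of_real x))) \<le> norm (f x)" for n
      by (simp add: norm_mult)
  qed measurable
qed

section \<open>Reflection symmetries and singular points\<close>

lemma Gminus_eq: "Gminus \<alpha> \<theta> = (\<lambda>x. Gplus \<alpha> \<theta> (- x))"
  by (auto simp: Gminus_def Gplus_def fun_eq_iff)

lemma Gplus_minus: "Gplus \<alpha> (- \<theta>) = (\<lambda>x. Gplus \<alpha> \<theta> (- x))"
  by (auto simp: Gplus_def fun_eq_iff)

lemma psi_minus: "psi \<alpha> (- \<theta>) (- \<xi>) = psi \<alpha> \<theta> \<xi>"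
  by (auto simp: psi_def)

text \<open>The simultaneous sign change exchanges the two elementary fractions. Together with
  \<open>Gplus_minus\<close> it carries the formula from positive to negative
  \<open>\<xi>\<close>.\<close>

lemma G_transform_minus: "G_transform \<alpha> (- \<theta>) (- \<xi>) = G_transform \<alpha> \<theta> \<xi>"
proof -
  have "1 / (- a - 1) = - (1 / (a + 1))" "1 / (- a + 1) = - (1 / (a - 1))" for a :: complex
    using minus_divide_right[of 1 "a + 1"] minus_divide_right[of 1 "a - 1"] by simp_all
  then show ?thesis
    unfolding G_transform_def psi_minus by simp
qed

lemma cmod_psi: "cmod (psi \<alpha> \<theta> \<xi>) = \<bar>\<xi>\<bar> powr \<alpha>"
  by (simp add: psi_def norm_mult)

text \<open>Comparing moduli: a vanishing denominator forces \<open>\<bar>\<xi>\<bar>\<close> or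
  \<open>\<bar>\<xi>\<bar> powr \<alpha>\<close> to be 1. Singular points are therefore
  isolated.\<close>

lemma G_transform_singular_imp:
  assumes "\<alpha> > 0" "G_transform_singular \<alpha> \<theta> \<xi>"
  shows "\<bar>\<xi>\<bar> = 1"
proof -
  have *: "cmod (exp (- (\<i> * complex_of_real \<theta>)) * complex_of_real \<xi>) = \<bar>\<xi>\<bar>"
    "cmod (exp (\<i> * complex_of_real \<theta>) * complex_of_real \<xi>) = \<bar>\<xi>\<bar>"
    by (simp_all add: norm_mult)
  from assms(2) consider "psi \<alpha> \<theta> \<xi> = 1" | "exp (- (\<i> * complex_of_real \<theta>)) * complex_of_real \<xi> = 1"
    | "exp (\<i> * complex_of_real \<theta>) * complex_of_real \<xi> = - 1"
    by (auto simp: G_transform_singular_def eq_neg_iff_add_eq_0)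
  then show ?thesis
  proof cases
    case 1
    then have "\<bar>\<xi>\<bar> powr \<alpha> = 1"
      using cmod_psi[of \<alpha> \<theta> \<xi>] by simp
    then have "\<xi> \<noteq> 0" and "ln (\<bar>\<xi>\<bar> powr \<alpha>) = 0"
      by auto
    then show ?thesis
      using assms(1) by (simp add: ln_powr)
  qed (use * in auto)
qed

lemma isCont_G_transform_0:
  assumes "\<alpha> > 0"
  shows "isCont (G_transform \<alpha> \<theta>) 0"
proof -
  have "((\<lambda>\<xi> :: real. \<bar>\<xi>\<bar> powr \<alpha>) \<longlongrightarrow> 0) (at 0)"
    by (rule tendsto_zero_powrI[OF tendsto_rabs_zero[OF tendsto_ident_at] tendsto_const]) (simp_all add: assms)
  then have "((\<lambda>\<xi>. cmod (psi \<alpha> \<theta> \<xi>)) \<longlongrightarrow> 0) (at 0)"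
    by (simp only: cmod_psi)
  then have psi: "(psi \<alpha> \<theta> \<longlongrightarrow> 0) (at 0)"
    by (rule tendsto_norm_zero_cancel)
  have \<xi>: "(complex_of_real \<longlongrightarrow> 0) (at 0)"
    using tendsto_of_real[OF tendsto_ident_at, of 0 UNIV] by simp
  have "(G_transform \<alpha> \<theta> \<longlongrightarrow> complex_of_real (sin (pi / \<alpha>)) *
      (complex_of_real \<alpha> / (0 - 1) - 1 / (exp (- (\<i> * complex_of_real \<theta>)) * 0 - 1)
        + 1 / (exp (\<i> * complex_of_real \<theta>) * 0 + 1))) (at 0)"
    unfolding G_transform_def
    by (intro tendsto_mult tendsto_add tendsto_diff tendsto_divide tendsto_const psi \<xi>) simp_all
  also have "complex_of_real (sin (pi / \<alpha>)) *
      (complex_of_real \<alpha> / (0 - 1) - 1 / (exp (- (\<i> * complex_of_real \<theta>)) * 0 - 1)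
        + 1 / (exp (\<i> * complex_of_real \<theta>) * 0 + 1)) = G_transform \<alpha> \<theta> 0"
    by (simp add: G_transform_def psi_def)
  finally show ?thesis
    by (simp add: isCont_def)
qed

section \<open>The transform for admissible parameters\<close>

context
  fixes \<alpha> \<theta> :: real
  assumes \<alpha>: "1 < \<alpha>" "\<alpha> < 2" and \<theta>: "\<bar>\<theta>\<bar> \<le> pi / \<alpha> - pi / 2"
begin

lemma abs_theta_less: "\<bar>\<theta>\<bar> < pi / 2"
proof -
  have "pi / \<alpha> < pi / 1"
    using \<alpha> by (intro divide_strict_left_mono) auto
  then show ?thesis
    using \<theta> by simp
qed

text \<open>The upper bounds are the hypothesis on \<theta> multiplied by \<alpha>. They make the
  sines in the weights nonnegative, and the strict lower bounds keep the cosines below 1.\<close>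

lemma angle_bounds:
  "0 < \<alpha> * (pi / 2 - \<theta>)" "\<alpha> * (pi / 2 - \<theta>) \<le> pi"
  "0 < \<alpha> * (pi / 2 + \<theta>)" "\<alpha> * (pi / 2 + \<theta>) \<le> pi"
proof -
  have "\<alpha> * (pi / 2 - \<theta>) \<le> \<alpha> * (pi / \<alpha>)" "\<alpha> * (pi / 2 + \<theta>) \<le> \<alpha> * (pi / \<alpha>)"
    using \<alpha> \<theta> by (intro mult_left_mono; simp add: abs_le_iff)+
  then show "\<alpha> * (pi / 2 - \<theta>) \<le> pi" "\<alpha> * (pi / 2 + \<theta>) \<le> pi"
    using \<alpha> by simp_all
  show "0 < \<alpha> * (pi / 2 - \<theta>)" "0 < \<alpha> * (pi / 2 + \<theta>)"
    using \<alpha> abs_theta_less by (auto intro!: mult_pos_pos)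
qed

abbreviation right_weight where "right_weight \<equiv> G_weight \<alpha> (\<alpha> * (pi / 2 - \<theta>))"
abbreviation left_weight where "left_weight \<equiv> G_weight \<alpha> (\<alpha> * (pi / 2 + \<theta>))"
abbreviation G_scale where "G_scale \<equiv> \<alpha> * sin (pi / \<alpha>) / pi"

lemma Gplus_eq_laplace:
  assumes "x > 0"
  shows "Gplus \<alpha> \<theta> x = G_scale * laplace right_weight x" "Gplus \<alpha> \<theta> (- x) = G_scale * laplace left_weight x"
  using assms by (simp_all add: Gplus_def G_integral_def laplace_def G_weight_def)

lemma G_scale_nonneg: "G_scale \<ge> 0"
proof -
  have "pi / \<alpha> \<le> pi / 1"
    using \<alpha> by (intro divide_left_mono) auto
  then have "sin (pi / \<alpha>) \<ge> 0"
    using \<alpha> by (intro sin_ge_zero) auto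
  then show ?thesis
    using \<alpha> by simp
qed

lemmas weight_facts =
  set_integrable_G_weight[OF \<alpha>(1) angle_bounds(1,2)] set_integrable_G_weight[OF \<alpha>(1) angle_bounds(3,4)]
  set_integrable_G_weight_div[OF \<alpha>(1) angle_bounds(1,2)] set_integrable_G_weight_div[OF \<alpha>(1) angle_bounds(3,4)]

lemma weight_nonneg: "t > 0 \<Longrightarrow> 0 \<le> right_weight t" "t > 0 \<Longrightarrow> 0 \<le> left_weight t"
  using G_weight_bounds(1)[OF _ \<alpha>(1)] angle_bounds by auto

lemma Gplus_bounded: "bounded (range (Gplus \<alpha> \<theta>))"
proof -
  \<comment> \<open>A sum of the two total masses rather than their maximum: both are nonnegative,
    so it bounds either side.\<close>
  define M where "M = G_scale * (LBINT t:{0<..}. right_weight t) + G_scale * (LBINT t:{0<..}. left_weight t)"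
  have nn: "0 \<le> (LBINT t:{0<..}. right_weight t)" "0 \<le> (LBINT t:{0<..}. left_weight t)"
    using abs_laplace_le[OF weight_facts(1) weight_nonneg(1), of 1]
      abs_laplace_le[OF weight_facts(2) weight_nonneg(2), of 1] by linarith+
  have "\<bar>Gplus \<alpha> \<theta> x\<bar> \<le> M" for x
  proof -
    consider "x > 0" | "x < 0" | "x = 0" by linarith
    then show ?thesis
    proof cases
      case 1
      have "\<bar>Gplus \<alpha> \<theta> x\<bar> = G_scale * \<bar>laplace right_weight x\<bar>"
        unfolding Gplus_eq_laplace(1)[OF 1] abs_mult using G_scale_nonneg by (simp only: abs_of_nonneg)
      also have "\<dots> \<le> G_scale * (LBINT t:{0<..}. right_weight t)"
        by (intro mult_left_mono G_scale_nonneg abs_laplace_le weight_facts weight_nonneg 1)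
      finally show ?thesis
        unfolding M_def using mult_nonneg_nonneg[OF G_scale_nonneg nn(2)] by linarith
    next
      case 2
      then have "- x > 0" by simp
      have "\<bar>Gplus \<alpha> \<theta> x\<bar> = G_scale * \<bar>laplace left_weight (- x)\<bar>"
        using Gplus_eq_laplace(2)[OF \<open>- x > 0\<close>] G_scale_nonneg by (simp only: minus_minus abs_mult abs_of_nonneg)
      also have "\<dots> \<le> G_scale * (LBINT t:{0<..}. left_weight t)"
        by (intro mult_left_mono G_scale_nonneg abs_laplace_le weight_facts weight_nonneg \<open>- x > 0\<close>)
      finally show ?thesis
        unfolding M_def using mult_nonneg_nonneg[OF G_scale_nonneg nn(1)] by linarith
    next
      case 3
      then show ?thesis
        unfolding M_def using mult_nonneg_nonneg[OF G_scale_nonneg nn(1)] mult_nonneg_nonneg[OF G_scale_nonneg nn(2)]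
        by (simp add: Gplus_def)
    qed
  qed
  then show ?thesis
    by (intro boundedI[of _ M]) auto
qed

lemma Gplus_completely_monotone:
  "completely_monotone (Gplus \<alpha> \<theta>)" "completely_monotone (\<lambda>x. Gplus \<alpha> \<theta> (- x))"
  using completely_monotone_laplace[OF weight_facts(1) weight_nonneg(1) G_scale_nonneg Gplus_eq_laplace(1)]
    completely_monotone_laplace[OF weight_facts(2) weight_nonneg(2) G_scale_nonneg Gplus_eq_laplace(2)]
  by blast+

lemma
  shows complex_integrable_Gplus_mult_exp:
      "complex_integrable lborel (\<lambda>x. complex_of_real (Gplus \<alpha> \<theta> x) * exp (- (\<i> * complex_of_real \<xi> * complex_of_real x)))"
    and fourier_Gplus: "fourier (\<lambda>x. complex_of_real (Gplus \<alpha> \<theta> x)) \<xi>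
      = complex_of_real G_scale * ((CLBINT t:{0<..}. complex_of_real (right_weight t) / (complex_of_real t + \<i> * complex_of_real \<xi>))
        + (CLBINT t:{0<..}. complex_of_real (left_weight t) / (complex_of_real t + \<i> * complex_of_real (- \<xi>))))"
proof -
  have "Gplus \<alpha> \<theta> 0 = 0"
    by (simp add: Gplus_def)
  moreover have scale: "complex_of_real (G_scale * laplace w x) * e = complex_of_real G_scale * (complex_of_real (laplace w x) * e)" for w x e
    by simp
  have "set_integrable lborel {0<..} (\<lambda>x. complex_of_real (G_scale * laplace right_weight x) * exp (- (\<i> * complex_of_real \<xi> * complex_of_real x)))"
    "set_integrable lborel {0<..} (\<lambda>x. complex_of_real (G_scale * laplace left_weight x) * exp (- (\<i> * complex_of_real (- \<xi>) * complex_of_real x)))"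
    unfolding scale
    by (intro set_integrable_mult_right set_integrable_laplace_mult_exp weight_facts weight_nonneg; assumption)+
  ultimately have *: "complex_integrable lborel (\<lambda>x. complex_of_real (Gplus \<alpha> \<theta> x) * exp (- (\<i> * complex_of_real \<xi> * complex_of_real x)))"
    "fourier (\<lambda>x. complex_of_real (Gplus \<alpha> \<theta> x)) \<xi>
      = (CLBINT x:{0<..}. complex_of_real (G_scale * laplace right_weight x) * exp (- (\<i> * complex_of_real \<xi> * complex_of_real x)))
      + (CLBINT x:{0<..}. complex_of_real (G_scale * laplace left_weight x) * exp (- (\<i> * complex_of_real (- \<xi>) * complex_of_real x)))"
    using fourier_two_sided[where H = "Gplus \<alpha> \<theta>" and h\<^sub>1 = "\<lambda>x. G_scale * laplace right_weight x" and h\<^sub>2 = "\<lambda>x. G_scale * laplace left_weight x",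
        OF _ Gplus_eq_laplace, of \<xi>] by blast+
  show "complex_integrable lborel (\<lambda>x. complex_of_real (Gplus \<alpha> \<theta> x) * exp (- (\<i> * complex_of_real \<xi> * complex_of_real x)))"
    by (fact *(1))
  show "fourier (\<lambda>x. complex_of_real (Gplus \<alpha> \<theta> x)) \<xi>
      = complex_of_real G_scale * ((CLBINT t:{0<..}. complex_of_real (right_weight t) / (complex_of_real t + \<i> * complex_of_real \<xi>))
        + (CLBINT t:{0<..}. complex_of_real (left_weight t) / (complex_of_real t + \<i> * complex_of_real (- \<xi>))))"
  proof -
    have "(CLBINT x:{0<..}. complex_of_real (laplace right_weight x) * exp (- (\<i> * complex_of_real \<xi> * complex_of_real x)))
        = (CLBINT t:{0<..}. complex_of_real (right_weight t) / (complex_of_real t + \<i> * complex_of_real \<xi>))"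
      by (intro LBINT_laplace_mult_exp weight_facts weight_nonneg)
    moreover have "(CLBINT x:{0<..}. complex_of_real (laplace left_weight x) * exp (- (\<i> * complex_of_real (- \<xi>) * complex_of_real x)))
        = (CLBINT t:{0<..}. complex_of_real (left_weight t) / (complex_of_real t + \<i> * complex_of_real (- \<xi>)))"
      by (intro LBINT_laplace_mult_exp weight_facts weight_nonneg)
    ultimately show ?thesis
      unfolding *(2) scale set_integral_mult_right distrib_left[of "complex_of_real G_scale"] by (simp only:)
  qed
qed

text \<open>At frequency 0 the exponential factor is 1.\<close>

lemma integrable_Gplus: "integrable lborel (Gplus \<alpha> \<theta>)"
  using complex_integrable_Gplus_mult_exp[of 0] by (simp add: complex_of_real_integrable_eq)

lemma fourier_Gplus_pos:
  assumes \<xi>: "\<xi> > 0" and nonsing: "\<not> G_transform_singular \<alpha> \<theta> \<xi>"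
  shows "fourier (\<lambda>x. complex_of_real (Gplus \<alpha> \<theta> x)) \<xi> = G_transform \<alpha> \<theta> \<xi>"
proof -
  \<comment> \<open>These are the points at which the two elementary denominators of
    \<open>G_transform\<close> become \<open>p - 1\<close> and \<open>- q + 1\<close>.\<close>
  define p q where "p = complex_of_real \<xi> * cis (- \<theta>)" and "q = - complex_of_real \<xi> * cis \<theta>"
  have pq: "exp (- (\<i> * complex_of_real \<theta>)) * complex_of_real \<xi> = p" "exp (\<i> * complex_of_real \<theta>) * complex_of_real \<xi> = - q"
    by (simp_all add: p_def q_def cis_conv_exp)
  have p1: "p \<noteq> 1" and q1: "q \<noteq> 1"
    using nonsing unfolding G_transform_singular_def pq by auto
  have inner_p: "cis (- \<theta>) \<bullet> p = \<xi>" and inner_q: "cis \<theta> \<bullet> q = - \<xi>"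
    unfolding p_def q_def using inner_cis_cis[of "- \<theta>" \<xi> "- \<theta>"] inner_cis_cis[of \<theta> "- \<xi>" \<theta>] by simp_all
  have i: "cis (pi / 2 - \<theta>) = \<i> * cis (- \<theta>)" "cis (- (pi / 2 - \<theta>)) = - \<i> * cis \<theta>"
    "cis (pi / 2 + \<theta>) = \<i> * cis \<theta>" "cis (- (pi / 2 + \<theta>)) = - \<i> * cis (- \<theta>)"
    by (simp_all add: complex_eq_iff cos_add sin_add cos_diff sin_diff)
  let ?z = "\<i> * complex_of_real \<xi>"
  \<comment> \<open>The kernel of the right weight has its pole at \<open>- ?z\<close>, that of the
    left weight at \<open>?z\<close>. Rotated onto their rays, both give the same pair
    \<open>p\<close>, \<open>q\<close>.\<close>
  have rep: "p = - ?z * cis (pi / 2 - \<theta>)" "q = - ?z * cis (- (pi / 2 - \<theta>))"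
    "q = ?z * cis (pi / 2 + \<theta>)" "p = ?z * cis (- (pi / 2 + \<theta>))"
    unfolding i by (simp_all add: p_def q_def mult_ac)
  have cos: "cos (\<alpha> * (pi / 2 - \<theta>)) < 1" "cos (\<alpha> * (pi / 2 + \<theta>)) < 1"
    using angle_bounds cos_monotone_0_pi[of 0] by auto
  then have cos': "cos (\<alpha> * - (pi / 2 - \<theta>)) < 1" "cos (\<alpha> * - (pi / 2 + \<theta>)) < 1"
    by (simp_all only: mult_minus_right cos_minus)
  have int: "set_integrable lborel {0..} (ray_integrand \<alpha> p (pi / 2 - \<theta>))"
    "set_integrable lborel {0..} (ray_integrand \<alpha> q (- (pi / 2 - \<theta>)))"
    "set_integrable lborel {0..} (ray_integrand \<alpha> q (pi / 2 + \<theta>))"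
    "set_integrable lborel {0..} (ray_integrand \<alpha> p (- (pi / 2 + \<theta>)))"
    by (rule set_integrable_ray_integrand[OF \<alpha>(1) cos(1) rep(1)] set_integrable_ray_integrand[OF \<alpha>(1) cos'(1) rep(2)]
        set_integrable_ray_integrand[OF \<alpha>(1) cos(2) rep(3)] set_integrable_ray_integrand[OF \<alpha>(1) cos'(2) rep(4)];
        use \<xi> in simp)+
  let ?I = "\<lambda>p \<beta>. CLBINT t:{0..}. ray_integrand \<alpha> p \<beta> t"
  have half: "(CLBINT t:{0<..}. f t) = (CLBINT t:{0..}. f t)" for f :: "real \<Rightarrow> complex"
    by (rule set_integral_discrete_difference[of "{0}"]) auto
  have w1: "(CLBINT t:{0<..}. complex_of_real (right_weight t) / (complex_of_real t + \<i> * complex_of_real \<xi>))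
      = 1 / (2 * \<i>) * (?I q (- (pi / 2 - \<theta>)) - ?I p (pi / 2 - \<theta>))"
  proof -
    have "complex_of_real (right_weight t) / (complex_of_real t + ?z)
        = 1 / (2 * \<i>) * (ray_integrand \<alpha> q (- (pi / 2 - \<theta>)) t - ray_integrand \<alpha> p (pi / 2 - \<theta>) t)" for t
      using G_weight_eq_ray_integrands[OF cos(1) rep(1,2), of t] by simp
    then show ?thesis
      using int by (simp only: half set_integral_mult_right set_integral_diff)
  qed
  have w2: "(CLBINT t:{0<..}. complex_of_real (left_weight t) / (complex_of_real t + \<i> * complex_of_real (- \<xi>)))
      = 1 / (2 * \<i>) * (?I p (- (pi / 2 + \<theta>)) - ?I q (pi / 2 + \<theta>))"
  proof -
    have "complex_of_real (left_weight t) / (complex_of_real t + \<i> * complex_of_real (- \<xi>))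
        = 1 / (2 * \<i>) * (ray_integrand \<alpha> p (- (pi / 2 + \<theta>)) t - ray_integrand \<alpha> q (pi / 2 + \<theta>) t)" for t
      using G_weight_eq_ray_integrands[OF cos(2) rep(3,4), of t] by simp
    then show ?thesis
      using int by (simp only: half set_integral_mult_right set_integral_diff)
  qed
  \<comment> \<open>The rays carrying \<open>p\<close> bound the half-plane with normal
    \<open>cis (- \<theta>)\<close>, those carrying \<open>q\<close> the one with normal
    \<open>cis \<theta>\<close>.\<close>
  have ang: "- \<theta> - pi / 2 = - (pi / 2 + \<theta>)" "- \<theta> + pi / 2 = pi / 2 - \<theta>"
    "\<theta> - pi / 2 = - (pi / 2 - \<theta>)" "\<theta> + pi / 2 = pi / 2 + \<theta>"
    by simp_all
  \<comment> \<open>Since \<open>cis (- \<theta>) \<bullet> p = \<xi> > 0\<close>, the pole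
    \<open>p\<close> is enclosed and its residue appears; for \<open>q\<close> the inner product is
    \<open>- \<xi>\<close>, so only the pole at 1 counts.\<close>
  have Ip: "?I p (- (pi / 2 + \<theta>)) - ?I p (pi / 2 - \<theta>) = 2 * pi * \<i> / (1 - p) * (1 / complex_of_real \<alpha> - unit_quot \<alpha> p)"
    using half_plane_ray_integrals[of \<alpha> "- \<theta>" p] \<alpha> abs_theta_less p1 inner_p \<xi> int(1,4) unfolding ang by simp
  have Iq: "?I q (- (pi / 2 - \<theta>)) - ?I q (pi / 2 + \<theta>) = 2 * pi * \<i> / (1 - q) * (1 / complex_of_real \<alpha>)"
    using half_plane_ray_integrals[of \<alpha> "\<theta>" q] \<alpha> abs_theta_less q1 inner_q \<xi> int(2,3) unfolding ang by simp
  have psi: "psi \<alpha> \<theta> \<xi> = p powr complex_of_real \<alpha>"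
    using powr_of_real_mult_cis[of \<xi> "- \<theta>" \<alpha>] \<xi> abs_theta_less
    by (simp add: psi_def p_def cis_conv_exp mult_ac)
  have psi1: "psi \<alpha> \<theta> \<xi> - 1 \<noteq> 0"
    using nonsing unfolding G_transform_singular_def by blast
  have quot: "unit_quot \<alpha> p = - (1 - p) / (psi \<alpha> \<theta> \<xi> - 1)"
    using p1 by (simp add: unit_quot_def psi)
  have "fourier (\<lambda>x. complex_of_real (Gplus \<alpha> \<theta> x)) \<xi> = complex_of_real G_scale * (1 / (2 * \<i>) *
      ((?I p (- (pi / 2 + \<theta>)) - ?I p (pi / 2 - \<theta>)) + (?I q (- (pi / 2 - \<theta>)) - ?I q (pi / 2 + \<theta>))))"
  proof -
    \<comment> \<open>Regrouping from pairs of rays with a common weight to pairs with a common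
      pole.\<close>
    have "x * (k * (A - B) + k * (C - D)) = x * (k * ((C - B) + (A - D)))" for x k A B C D :: complex
      by (simp add: algebra_simps)
    then show ?thesis
      unfolding fourier_Gplus w1 w2 .
  qed
  also have "\<dots> = complex_of_real (sin (pi / \<alpha>)) * (complex_of_real \<alpha> / (psi \<alpha> \<theta> \<xi> - 1) + 1 / (1 - p) + 1 / (1 - q))"
  proof -
    have "a * s / \<pi> * (1 / (2 * \<i>) * (2 * \<pi> * \<i> / u * (1 / a - - u / P) + 2 * \<pi> * \<i> / v * (1 / a)))
        = s * (a / P + 1 / u + 1 / v)"
      if "a \<noteq> 0" "\<pi> \<noteq> 0" "P \<noteq> 0" "u \<noteq> 0" "v \<noteq> 0" for a s \<pi> P u v :: complex
      using that by (simp add: field_simps)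
    note eq = this[of "complex_of_real \<alpha>" "complex_of_real pi" "psi \<alpha> \<theta> \<xi> - 1" "1 - p" "1 - q" "complex_of_real (sin (pi / \<alpha>))"]
    show ?thesis
      unfolding Ip Iq quot of_real_mult of_real_divide of_real_numeral
      by (rule eq) (use \<alpha> psi1 p1 q1 in simp_all)
  qed
  also have "\<dots> = complex_of_real (sin (pi / \<alpha>)) * (complex_of_real \<alpha> / (psi \<alpha> \<theta> \<xi> - 1) - 1 / (p - 1) + 1 / (- q + 1))"
  proof -
    have "1 / (1 - p) = - (1 / (p - 1))" "1 / (1 - q) = 1 / (- q + 1)"
      by (simp_all only: minus_divide_right minus_diff_eq uminus_add_conv_diff)
    then show ?thesis
      by (simp only: add_uminus_conv_diff)
  qed
  also have "\<dots> = G_transform \<alpha> \<theta> \<xi>"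
    unfolding G_transform_def pq ..
  finally show ?thesis .
qed

end

lemma fourier_Gplus_nonzero:
  assumes \<alpha>: "1 < \<alpha>" "\<alpha> < 2" and \<theta>: "\<bar>\<theta>\<bar> \<le> pi / \<alpha> - pi / 2"
    and \<xi>: "\<xi> \<noteq> 0" and nonsing: "\<not> G_transform_singular \<alpha> \<theta> \<xi>"
  shows "fourier (\<lambda>x. complex_of_real (Gplus \<alpha> \<theta> x)) \<xi> = G_transform \<alpha> \<theta> \<xi>"
proof (cases "\<xi> > 0")
  case True
  then show ?thesis
    using fourier_Gplus_pos[OF \<alpha> \<theta>] nonsing by blast
next
  case False
  have "\<not> G_transform_singular \<alpha> (- \<theta>) (- \<xi>)"
  proof -
    have "- a + 1 = - (a - 1)" "- a - 1 = - (a + 1)" for a :: complex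
      by simp_all
    then have "- a + 1 = 0 \<longleftrightarrow> a - 1 = 0" "- a - 1 = 0 \<longleftrightarrow> a + 1 = 0" for a :: complex
      by (simp_all only: neg_equal_0_iff_equal)
    then show ?thesis
      using nonsing unfolding G_transform_singular_def psi_minus by simp
  qed
  then have "fourier (\<lambda>x. complex_of_real (Gplus \<alpha> (- \<theta>) x)) (- \<xi>) = G_transform \<alpha> (- \<theta>) (- \<xi>)"
    using \<theta> \<xi> False by (intro fourier_Gplus_pos[OF \<alpha>]) auto
  then show ?thesis
    unfolding Gplus_minus G_transform_minus fourier_reflect[of "\<lambda>x. complex_of_real (Gplus \<alpha> \<theta> x)"] .
qed

text \<open>The Fourier transform of an integrable function is continuous, and it agrees with the
  formula off the three points 0, 1 and -1, hence on a punctured neighbourhood of any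
  \<open>\<xi>\<close>.\<close>

lemma G_transform_tendsto_fourier:
  assumes \<alpha>: "1 < \<alpha>" "\<alpha> < 2" and \<theta>: "\<bar>\<theta>\<bar> \<le> pi / \<alpha> - pi / 2"
  shows "(G_transform \<alpha> \<theta> \<longlongrightarrow> fourier (\<lambda>x. complex_of_real (Gplus \<alpha> \<theta> x)) \<xi>) (at \<xi>)"
proof -
  let ?F = "fourier (\<lambda>x. complex_of_real (Gplus \<alpha> \<theta> x))"
  have "isCont ?F \<xi>"
    using integrable_Gplus[OF \<alpha> \<theta>] by (intro isCont_fourier) (simp add: complex_of_real_integrable_eq)
  then have "(?F \<longlongrightarrow> ?F \<xi>) (at \<xi>)"
    by (simp add: isCont_def)
  moreover have "\<forall>\<^sub>F \<eta> in at \<xi>. ?F \<eta> = G_transform \<alpha> \<theta> \<eta>"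
    using eventually_neq_at_within[of 0 \<xi> UNIV] eventually_neq_at_within[of 1 \<xi> UNIV]
      eventually_neq_at_within[of "-1" \<xi> UNIV]
  proof eventually_elim
    case (elim \<eta>)
    then have "\<bar>\<eta>\<bar> \<noteq> 1"
      by linarith
    then have "\<not> G_transform_singular \<alpha> \<theta> \<eta>"
      using G_transform_singular_imp[of \<alpha> \<theta> \<eta>] \<alpha> by auto
    with elim show ?case
      by (intro fourier_Gplus_nonzero[OF \<alpha> \<theta>])
  qed
  ultimately show ?thesis
    by (rule Lim_transform_eventually)
qed

theorem proposition1p3:
  fixes \<alpha> \<theta> :: real
  assumes "1 < \<alpha>" and "\<alpha> < 2"
    and "\<bar>\<theta>\<bar> \<le> pi / \<alpha> - pi / 2"
  shows "bounded (range (Gplus \<alpha> \<theta>)) \<and> bounded (range (Gminus \<alpha> \<theta>))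
    \<and> integrable lborel (Gplus \<alpha> \<theta>) \<and> integrable lborel (Gminus \<alpha> \<theta>)
    \<and> (\<forall>\<xi>. fourier (\<lambda>x. complex_of_real (Gplus \<alpha> \<theta> x)) \<xi>
            = fourier (\<lambda>x. complex_of_real (Gminus \<alpha> \<theta> x)) (- \<xi>))
    \<and> (\<forall>\<xi>. \<not> G_transform_singular \<alpha> \<theta> \<xi> \<longrightarrow>
            fourier (\<lambda>x. complex_of_real (Gplus \<alpha> \<theta> x)) \<xi> = G_transform \<alpha> \<theta> \<xi>)
    \<and> (\<forall>\<xi>. G_transform_singular \<alpha> \<theta> \<xi> \<longrightarrow>
            (G_transform \<alpha> \<theta> \<longlongrightarrow> fourier (\<lambda>x. complex_of_real (Gplus \<alpha> \<theta> x)) \<xi>) (at \<xi>))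
    \<and> (\<forall>x>0. Gplus \<alpha> \<theta> x = Gminus \<alpha> \<theta> (- x))
    \<and> (\<forall>x>0. Gplus \<alpha> \<theta> (- x) = Gminus \<alpha> \<theta> x)
    \<and> completely_monotone (\<lambda>x. Gplus \<alpha> \<theta> x)
    \<and> completely_monotone (\<lambda>x. Gminus \<alpha> \<theta> (- x))
    \<and> completely_monotone (\<lambda>x. Gplus \<alpha> \<theta> (- x))
    \<and> completely_monotone (\<lambda>x. Gminus \<alpha> \<theta> x)"
proof -
  note \<alpha>\<theta> = assms
  let ?F = "fourier (\<lambda>x. complex_of_real (Gplus \<alpha> \<theta> x))"
  have eq: "?F \<xi> = G_transform \<alpha> \<theta> \<xi>" if "\<not> G_transform_singular \<alpha> \<theta> \<xi>" for \<xi>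
  proof (cases "\<xi> = 0")
    case True
    \<comment> \<open>At frequency 0 the formula is regular, so its own value and the Fourier
      transform are limits of the same function.\<close>
    have "(G_transform \<alpha> \<theta> \<longlongrightarrow> G_transform \<alpha> \<theta> 0) (at 0)"
      using isCont_G_transform_0[of \<alpha> \<theta>] assms by (simp add: isCont_def)
    then show ?thesis
      unfolding True using G_transform_tendsto_fourier[OF \<alpha>\<theta>, of 0] by (intro LIM_unique)
  next
    case False
    then show ?thesis
      using fourier_Gplus_nonzero[OF \<alpha>\<theta>] that by blast
  qed
  have "bounded (range (Gminus \<alpha> \<theta>))"
    using Gplus_bounded[OF \<alpha>\<theta>] unfolding Gminus_eq by (rule bounded_subset) auto
  moreover have "integrable lborel (Gminus \<alpha> \<theta>)"
    using lborel_integrable_real_affine_iff[of "-1" "Gplus \<alpha> \<theta>" 0] integrable_Gplus[OF \<alpha>\<theta>]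
    unfolding Gminus_eq by simp
  moreover have "?F \<xi> = fourier (\<lambda>x. complex_of_real (Gminus \<alpha> \<theta> x)) (- \<xi>)" for \<xi>
    unfolding Gminus_eq by (rule fourier_reflect[of "\<lambda>x. complex_of_real (Gplus \<alpha> \<theta> x)", symmetric])
  ultimately show ?thesis
    using Gplus_bounded[OF \<alpha>\<theta>] integrable_Gplus[OF \<alpha>\<theta>] eq G_transform_tendsto_fourier[OF \<alpha>\<theta>]
      Gplus_completely_monotone[OF \<alpha>\<theta>]
    unfolding Gminus_eq minus_minus by blast
qed

end
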